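(* Let $N\ge3$ and $\zeta^N=-1$. The short periods of the $(\mathfrak a_1,\mathfrak a_{N-1})$ Argyres-Douglas theory may be expressed (as in the context) in terms of the function $R(\zeta)$, which admits the following infinite series expansion in $v_1,\dots,v_{N-2}$ (for $v\neq0$ and $|v_1|,\dots,|v_{N-2}|$ sufficiently small): $$ R(\zeta)=-\frac{v^{\frac12+\frac1N}}{\sqrt{2\pi}\,N}\sum_{\ell_1,\dots,\ell_{N-2}=0}^{\infty}(-1)^{M}\,\zeta^{L}\;\frac{v_1^{\ell_1}\cdots v_{N-2}^{\ell_{N-2}}}{\ell_1!\cdots\ell_{N-2}!}\;\frac{\Gamma\!\left(\tfrac LN\right)}{\Gamma\!\left(\tfrac32+\tfrac LN-M\right)}, $$ where $L=1+\sum_{j=1}^{N-2}j\,\ell_j$ and $M=\sum_{j=1}^{N-2}\ell_j$.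
   Context: The (intrinsic) Seiberg-Witten curve and differential of the $(\mathfrak a_1,\mathfrak a_{N-1})$ theory, obtained as the limit in which the strong coupling scale of $SU(N)$ super Yang-Mills is sent to infinity at the maximal Argyres-Douglas point, are $$\hat y^2=x^N-\sum_{n=1}^{N-2}u_nx^n+v,\qquad \lambda=\sqrt{-2}\;\hat y\,dx .$$ Let $v\ne0$, fix a branch of $\log v$ (used for all powers of $v$), and put $v_n=v^{\frac nN-1}u_n$ for $1\le n\le N-2$ and $x=v^{1/N}z$. For small $v_1,\dots,v_{N-2}$ and each $\zeta$ with $\zeta^N=-1$, the polynomial $z^N-\sum_{n=1}^{N-2}v_nz^n+1$ has a unique root $z_\zeta$ near $\zeta$ (with $z_\zeta=\zeta$ when all $v_n=0$). $R(\zeta)$ is defined by $i\pi R(\zeta)=\int_{z=0}^{z=z_\zeta}\lambda$, along a small deformation of the segment $[0,\zeta]$ in the $z$-plane, with $\hat y$ continued from $\hat y=v^{1/2}$ at $z=0$ and with the sign convention $\sqrt{-2}=-i\sqrt2$ (the opposite choice reverses the overall sign of $R$). With $\varepsilon=e^{2\pi i/(2N)}$, the short periods are, for $1\le i\le\lfloor\frac{N-1}2\rfloor$, $$a_i^{(s)}=\sum_{j=1}^{i}\left(R(\varepsilon^{4j-1})-R(\varepsilon^{4j-3})\right),\qquad a_{D,i}^{(s)}=R(\varepsilon^{4i+1})-R(\varepsilon^{4i-1}).$$ By convention $1/\Gamma(p)=0$ when $p$ is a non-positive integer. *)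

theory Defs
  imports "HOL-Analysis.Analysis"
begin

text \<open>
  Powers of \<open>v\<close> are taken with respect to a fixed logarithm \<open>lv\<close> of \<open>v\<close>
  (any complex number with \<open>exp lv = v\<close>): \<open>v\<^sup>p = exp (p lv)\<close>.
\<close>

definition vpow :: "complex \<Rightarrow> real \<Rightarrow> complex" where
  "vpow lv p = exp (of_real p * lv)"

text \<open>Right-hand side of the Seiberg-Witten curve \<open>y\<^sup>2 = x\<^sup>N - \<Sum> u\<^sub>n x\<^sup>n + v\<close>.\<close>

definition SW_curve :: "nat \<Rightarrow> (nat \<Rightarrow> complex) \<Rightarrow> complex \<Rightarrow> complex \<Rightarrow> complex" where
  "SW_curve N u v x = x ^ N - (\<Sum>n=1..N-2. u n * x ^ n) + v"

text \<open>The rescaled moduli \<open>v\<^sub>n = v\<^bsup>n/N - 1\<^esup> u\<^sub>n\<close>.\<close>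

definition vmod :: "nat \<Rightarrow> complex \<Rightarrow> (nat \<Rightarrow> complex) \<Rightarrow> nat \<Rightarrow> complex" where
  "vmod N lv u n = vpow lv (real n / real N - 1) * u n"

definition zpoly :: "nat \<Rightarrow> (nat \<Rightarrow> complex) \<Rightarrow> complex \<Rightarrow> complex" where
  "zpoly N c z = z ^ N - (\<Sum>n=1..N-2. c n * z ^ n) + 1"

text \<open>
  The branch point \<open>z\<^sub>\<zeta>\<close>. The radius \<open>\<rho>\<close> makes precise what ``near'' and
  ``small deformation'' mean, here and below.
\<close>

definition branch_point :: "real \<Rightarrow> nat \<Rightarrow> (nat \<Rightarrow> complex) \<Rightarrow> complex \<Rightarrow> complex" where
  "branch_point \<rho> N c \<zeta> = (THE z. z \<in> ball \<zeta> \<rho> \<and> zpoly N c z = 0)"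

text \<open>
  \<open>\<gamma>\<close> is a path in the \<open>z\<close>-plane from \<open>0\<close> to \<open>z\<^sub>\<zeta>\<close> that is uniformly \<open>\<rho>\<close>-close to
  the segment \<open>[0,\<zeta>]\<close> and meets no branch point before its end, and \<open>y t\<close> is the
  value at the point \<open>x = v\<^bsup>1/N\<^esup> \<gamma> t\<close> of the curve, continued along \<open>\<gamma>\<close> from
  \<open>v\<^bsup>1/2\<^esup>\<close>. As \<open>y\<close> is two-valued as a function of \<open>x\<close>, it is a function of the
  path parameter.
\<close>

definition lifted_segment ::
  "real \<Rightarrow> nat \<Rightarrow> (nat \<Rightarrow> complex) \<Rightarrow> complex \<Rightarrow> complex \<Rightarrow> complex
    \<Rightarrow> (real \<Rightarrow> complex) \<Rightarrow> (real \<Rightarrow> complex) \<Rightarrow> bool" where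
  "lifted_segment \<rho> N u v lv \<zeta> \<gamma> y \<longleftrightarrow>
     valid_path \<gamma> \<and> pathstart \<gamma> = 0 \<and>
     pathfinish \<gamma> = branch_point \<rho> N (vmod N lv u) \<zeta> \<and>
     (\<forall>t\<in>{0..1}. dist (\<gamma> t) (linepath 0 \<zeta> t) < \<rho>) \<and>
     (\<forall>t\<in>{0..<1}. zpoly N (vmod N lv u) (\<gamma> t) \<noteq> 0) \<and>
     continuous_on {0..1} y \<and> y 0 = vpow lv (1/2) \<and>
     (\<forall>t\<in>{0..1}. (y t)\<^sup>2 = SW_curve N u v (vpow lv (1 / real N) * \<gamma> t))"

text \<open>
  \<open>I\<close> is the integral of \<open>\<lambda> = \<surd>-2 y dx\<close>, with \<open>\<surd>-2 = -\<i> \<surd>2\<close>, along such a lifted path.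
\<close>

definition has_SW_integral ::
  "real \<Rightarrow> nat \<Rightarrow> (nat \<Rightarrow> complex) \<Rightarrow> complex \<Rightarrow> complex \<Rightarrow> complex \<Rightarrow> complex \<Rightarrow> bool" where
  "has_SW_integral \<rho> N u v lv \<zeta> I \<longleftrightarrow>
     (\<exists>\<gamma> y. lifted_segment \<rho> N u v lv \<zeta> \<gamma> y \<and>
        ((\<lambda>t. (- \<i> * of_real (sqrt 2)) * y t *
              vector_derivative (\<lambda>s. vpow lv (1 / real N) * \<gamma> s) (at t within {0..1}))
          has_integral I) {0..1})"

definition SW_R ::
  "real \<Rightarrow> nat \<Rightarrow> (nat \<Rightarrow> complex) \<Rightarrow> complex \<Rightarrow> complex \<Rightarrow> complex \<Rightarrow> complex" where
  "SW_R \<rho> N u v lv \<zeta> = (THE r. has_SW_integral \<rho> N u v lv \<zeta> (\<i> * of_real pi * r))"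

definition eps :: "nat \<Rightarrow> complex" where
  "eps N = exp (2 * of_real pi * \<i> / (2 * of_nat N))"

definition short_a ::
  "real \<Rightarrow> nat \<Rightarrow> (nat \<Rightarrow> complex) \<Rightarrow> complex \<Rightarrow> complex \<Rightarrow> nat \<Rightarrow> complex" where
  "short_a \<rho> N u v lv i =
     (\<Sum>j=1..i. SW_R \<rho> N u v lv (eps N ^ (4*j - 1)) - SW_R \<rho> N u v lv (eps N ^ (4*j - 3)))"

definition short_aD ::
  "real \<Rightarrow> nat \<Rightarrow> (nat \<Rightarrow> complex) \<Rightarrow> complex \<Rightarrow> complex \<Rightarrow> nat \<Rightarrow> complex" where
  "short_aD \<rho> N u v lv i =
     SW_R \<rho> N u v lv (eps N ^ (4*i + 1)) - SW_R \<rho> N u v lv (eps N ^ (4*i - 1))"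

definition Lsum :: "nat \<Rightarrow> (nat \<Rightarrow> nat) \<Rightarrow> nat" where
  "Lsum N l = 1 + (\<Sum>j=1..N-2. j * l j)"

definition Msum :: "nat \<Rightarrow> (nat \<Rightarrow> nat) \<Rightarrow> nat" where
  "Msum N l = (\<Sum>j=1..N-2. l j)"

text \<open>
  Summand at the multi-index \<open>l\<close>. The entire function \<open>rGamma\<close> is \<open>1/\<Gamma>\<close>, with value
  \<open>0\<close> at the non-positive integers.
\<close>

definition R_term :: "nat \<Rightarrow> complex \<Rightarrow> (nat \<Rightarrow> complex) \<Rightarrow> (nat \<Rightarrow> nat) \<Rightarrow> complex" where
  "R_term N \<zeta> c l =
     (-1) ^ Msum N l * \<zeta> ^ Lsum N l *
     ((\<Prod>j=1..N-2. c j ^ l j) / (\<Prod>j=1..N-2. fact (l j))) *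
     (Gamma (of_nat (Lsum N l) / of_nat N) *
      rGamma (3/2 + of_nat (Lsum N l) / of_nat N - of_nat (Msum N l)))"

end

theory Submission
  imports Defs "HOL-Complex_Analysis.Complex_Analysis"
begin

text \<open>
  Rescaling \<open>x = v\<^bsup>1/N\<^esup> \<zeta> s\<close> moves the branch point to a root \<open>a\<close> near \<open>1\<close> of
  \<open>1 - s\<^sup>N - \<Sum> b\<^sub>n s\<^sup>n\<close> with \<open>b\<^sub>n = v\<^sub>n \<zeta>\<^sup>n\<close>. On a convex tube around \<open>[0,1]\<close> this polynomial is
  \<open>(a - s) q(s)\<^sup>2\<close> with \<open>q\<close> holomorphic. In the coordinate \<open>w\<close> with \<open>s = a - w\<^sup>2\<close> the differential
  has an odd primitive, so the integral along every admissible path from \<open>0\<close> to \<open>a\<close> is the same,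
  and it is minus one half of the integral over a loop that starts on the sheet \<open>-y\<close> at \<open>0\<close>,
  goes around \<open>a\<close> and returns to \<open>0\<close> on the sheet \<open>y\<close>. The loop can be chosen independently of
  the \<open>b\<^sub>n\<close> and away from the branch points, so \<open>y = (1 - s\<^sup>N - \<Sum> b\<^sub>n s\<^sup>n)\<^bsup>1/2\<^esup>\<close> may be expanded
  under the integral by the binomial and multinomial theorems. The resulting loop integrals of
  \<open>s\<^sup>L\<^sup>-\<^sup>1 (1 - s\<^sup>N)\<^bsup>1/2 - M\<^esup>\<close> reduce to the Beta integral at \<open>M = 0\<close> by a recurrence in \<open>M\<close>.
\<close>

section \<open>Multinomial series\<close>

text \<open>Valued in any field of characteristic 0, so that one constant provides both the complex
  coefficients and their real majorants.\<close>

definition multinom :: "'i set \<Rightarrow> ('i \<Rightarrow> nat) \<Rightarrow> 'a::field_char_0" where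
  "multinom A l = fact (sum l A) / (\<Prod>i\<in>A. fact (l i))"

lemma finite_PiE_sum_eq:
  assumes "finite A"
  shows "finite {l \<in> A \<rightarrow>\<^sub>E UNIV. sum l A = (M::nat)}"
proof (rule finite_subset)
  show "{l \<in> A \<rightarrow>\<^sub>E UNIV. sum l A = M} \<subseteq> A \<rightarrow>\<^sub>E {..M}"
  proof
    fix l assume l: "l \<in> {l \<in> A \<rightarrow>\<^sub>E UNIV. sum l A = M}"
    have "l i \<le> M" if "i \<in> A" for i
      using member_le_sum[of i A l] assms that l by auto
    with l show "l \<in> A \<rightarrow>\<^sub>E {..M}" by (auto simp: PiE_iff)
  qed
qed (use assms in \<open>simp add: finite_PiE\<close>)

text \<open>Induction on \<open>A\<close>: the binomial theorem splits off the exponent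
  \<open>k\<close> of \<open>x a\<close>. Exponents are extensional functions, so a multi-index on
  \<open>insert a A\<close> amounts to a pair of \<open>k\<close> and a multi-index on
  \<open>A\<close>.\<close>

theorem multinomial_theorem:
  fixes x :: "'i \<Rightarrow> 'a::field_char_0"
  assumes "finite A"
  shows "(\<Sum>i\<in>A. x i) ^ M = (\<Sum>l | l \<in> A \<rightarrow>\<^sub>E UNIV \<and> sum l A = M. multinom A l * (\<Prod>i\<in>A. x i ^ l i))"
  using assms
proof (induction A arbitrary: M)
  case empty
  have "{l. l \<in> {} \<rightarrow>\<^sub>E UNIV \<and> sum l {} = M} = (if M = 0 then {\<lambda>_. undefined} else {} :: ('i \<Rightarrow> nat) set)"
    by auto
  then show ?case by (simp add: multinom_def)
next
  case (insert a A)
  define L where "L = (\<lambda>B m. {l. l \<in> B \<rightarrow>\<^sub>E UNIV \<and> sum l B = (m::nat)} :: ('i \<Rightarrow> nat) set)"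
  have sum_if: "(\<Sum>i\<in>A. if i = a then c else g i) = sum g A" for g :: "'i \<Rightarrow> nat" and c
    using insert.hyps by (intro sum.cong) auto
  have prod_fact_if: "(\<Prod>i\<in>A. fact (if i = a then c else g i)) = (\<Prod>i\<in>A. fact (g i) :: 'a)"
    for g :: "'i \<Rightarrow> nat" and c
    using insert.hyps by (intro prod.cong) auto
  have prod_power_if: "(\<Prod>i\<in>A. x i ^ (if i = a then c else g i)) = (\<Prod>i\<in>A. x i ^ g i)"
    for g :: "'i \<Rightarrow> nat" and c
    using insert.hyps by (intro prod.cong) auto
  have "(\<Sum>i\<in>insert a A. x i) ^ M
      = (\<Sum>k\<le>M. of_nat (M choose k) * x a ^ k * (\<Sum>i\<in>A. x i) ^ (M - k))"
    using insert.hyps by (simp add: binomial_ring)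
  also have "\<dots> = (\<Sum>k\<le>M. \<Sum>g\<in>L A (M - k).
      of_nat (M choose k) * x a ^ k * (multinom A g * (\<Prod>i\<in>A. x i ^ g i)))"
    unfolding insert.IH L_def by (simp add: sum_distrib_left)
  also have "\<dots> = (\<Sum>(k, g)\<in>Sigma {..M} (\<lambda>k. L A (M - k)).
      of_nat (M choose k) * x a ^ k * (multinom A g * (\<Prod>i\<in>A. x i ^ g i)))"
    using finite_PiE_sum_eq[OF insert.hyps(1)] by (intro sum.Sigma) (auto simp: L_def)
  also have "\<dots> = (\<Sum>l\<in>L (insert a A) M. multinom (insert a A) l * (\<Prod>i\<in>insert a A. x i ^ l i))"
  proof (intro sum.reindex_bij_witness[of _ "\<lambda>l. (l a, l(a := undefined))" "\<lambda>(k, g). g(a := k)"], goal_cases)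
    case (1 kg)
    then show ?case using insert.hyps by (auto simp: L_def PiE_iff extensional_def fun_eq_iff)
  next
    case (2 kg)
    then show ?case using insert.hyps
      by (auto simp: L_def PiE_iff extensional_def fun_eq_iff sum_if)
  next
    case (3 l)
    then show ?case by auto
  next
    case (4 l)
    then show ?case using insert.hyps
      by (auto simp: L_def PiE_iff extensional_def sum_if)
  next
    case (5 kg)
    obtain k g where kg: "kg = (k, g)" by force
    have k: "k \<le> M" and g: "sum g A = M - k" using 5 kg by (auto simp: L_def)
    \<comment> \<open>The factor \<open>fact (M - k)\<close> in the denominator of the binomial
      coefficient cancels against the numerator of \<open>multinom A g\<close>.\<close>
    have "multinom (insert a A) (g(a := k)) = of_nat (M choose k) * (multinom A g :: 'a)"
      using insert.hyps k
      by (simp add: multinom_def sum_if g binomial_fact prod_fact_if)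
    then show ?case
      using insert.hyps by (simp add: kg prod_power_if)
  qed
  finally show ?case by (simp add: L_def)
qed

text \<open>Groups the multi-indices by total degree, which turns a sum over all of them into a
  series of finite sums.\<close>

lemma PiE_UNIV_Sigma:
  "bij_betw snd (Sigma UNIV (\<lambda>M. {l \<in> A \<rightarrow>\<^sub>E UNIV. sum l A = (M::nat)})) (A \<rightarrow>\<^sub>E UNIV)"
  by (rule bij_betwI[where g = "\<lambda>l. (sum l A, l)"]) auto

lemma multinom_nonneg: "multinom A l \<ge> (0::real)"
  by (simp add: multinom_def prod_nonneg)

lemma norm_multinom [simp]: "norm (multinom A l :: complex) = multinom A l"
  by (simp add: multinom_def norm_divide prod_norm [symmetric])

text \<open>The terms of total degree \<open>M\<close> add up to \<open>sum r A ^ M\<close>, which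
  leaves a geometric series.\<close>

lemma summable_multinom:
  fixes r :: "'i \<Rightarrow> real"
  assumes "finite A" "\<And>i. i \<in> A \<Longrightarrow> r i \<ge> 0" "sum r A < 1"
  shows "(\<lambda>l. multinom A l * (\<Prod>i\<in>A. r i ^ l i)) summable_on (A \<rightarrow>\<^sub>E UNIV)"
proof -
  have "(\<lambda>p. multinom A (snd p) * (\<Prod>i\<in>A. r i ^ snd p i))
      summable_on (Sigma UNIV (\<lambda>M. {l \<in> A \<rightarrow>\<^sub>E UNIV. sum l A = M}))"
  proof (rule summable_on_SigmaI)
    fix M :: nat
    show "((\<lambda>l. multinom A (snd (M, l)) * (\<Prod>i\<in>A. r i ^ snd (M, l) i)) has_sum sum r A ^ M)
        {l \<in> A \<rightarrow>\<^sub>E UNIV. sum l A = M}"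
      unfolding multinomial_theorem[OF assms(1)]
      by (intro has_sum_finiteI finite_PiE_sum_eq assms) auto
    show "(\<lambda>M. sum r A ^ M) summable_on UNIV"
      using assms by (auto simp: summable_on_UNIV_nonneg_real_iff sum_nonneg intro!: summable_geometric)
  qed (use assms in \<open>auto intro!: mult_nonneg_nonneg multinom_nonneg prod_nonneg\<close>)
  then show ?thesis
    using summable_on_reindex_bij_betw[OF PiE_UNIV_Sigma, of "\<lambda>l. multinom A l * (\<Prod>i\<in>A. r i ^ l i)"]
    by (simp add: comp_def)
qed

text \<open>Since \<open>\<phi>\<close> is bounded by 1, the multinomial family of the norms is a
  summable majorant. This permits summation degree by degree, where the multinomial theorem
  applies.\<close>

lemma has_sum_multinom:
  fixes x :: "'i \<Rightarrow> complex"
  assumes fin: "finite A" and "(\<Sum>i\<in>A. norm (x i)) < 1" and \<phi>: "\<And>M. norm (\<phi> M) \<le> 1"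
    and S: "(\<lambda>M. \<phi> M * (\<Sum>i\<in>A. x i) ^ M) sums S"
  shows "((\<lambda>l. \<phi> (sum l A) * (multinom A l * (\<Prod>i\<in>A. x i ^ l i))) has_sum S) (A \<rightarrow>\<^sub>E UNIV)"
proof -
  let ?f = "\<lambda>l. \<phi> (sum l A) * (multinom A l * (\<Prod>i\<in>A. x i ^ l i))"
  let ?L = "\<lambda>M. {l \<in> A \<rightarrow>\<^sub>E UNIV. sum l A = M}"
  have "(\<lambda>l. norm (?f l)) summable_on (A \<rightarrow>\<^sub>E UNIV)"
  proof (rule summable_on_comparison_test)
    show "(\<lambda>l. multinom A l * (\<Prod>i\<in>A. norm (x i) ^ l i)) summable_on (A \<rightarrow>\<^sub>E UNIV)"
      by (rule summable_multinom) (use assms in auto)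
    fix l :: "'i \<Rightarrow> nat"
    show "norm (?f l) \<le> multinom A l * (\<Prod>i\<in>A. norm (x i) ^ l i)"
      using mult_right_mono[OF \<phi>[of "sum l A"], of "multinom A l * (\<Prod>i\<in>A. norm (x i) ^ l i)"]
      by (simp add: norm_mult prod_norm [symmetric] norm_power multinom_nonneg prod_nonneg)
  qed auto
  then have "?f summable_on (A \<rightarrow>\<^sub>E UNIV)" by (rule abs_summable_summable)
  then have sm: "(\<lambda>p. ?f (snd p)) summable_on Sigma UNIV ?L"
    using summable_on_reindex_bij_betw[OF PiE_UNIV_Sigma, of ?f] by (simp add: comp_def)
  have "((\<lambda>p. ?f (snd p)) has_sum S) (Sigma UNIV ?L)"
  proof (rule has_sum_SigmaI[OF _ _ sm])
    fix M :: nat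
    show "((\<lambda>l. ?f (snd (M, l))) has_sum \<phi> M * (\<Sum>i\<in>A. x i) ^ M) (?L M)"
      unfolding multinomial_theorem[OF fin] sum_distrib_left
      by (intro has_sum_finiteI finite_PiE_sum_eq fin sum.cong) auto
  next
    have "norm (\<Sum>i\<in>A. x i) < 1" using assms(2) norm_sum[of x A] by linarith
    then have "summable (\<lambda>M. norm (\<phi> M * (\<Sum>i\<in>A. x i) ^ M))"
      using \<phi> by (intro summable_comparison_test'[OF summable_geometric[of "norm (\<Sum>i\<in>A. x i)"], of 0])
        (auto simp: norm_mult norm_power intro!: mult_left_le_one_le)
    then show "((\<lambda>M. \<phi> M * (\<Sum>i\<in>A. x i) ^ M) has_sum S) UNIV"
      using S by (rule norm_summable_imp_has_sum)
  qed
  then show ?thesis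
    using has_sum_reindex_bij_betw[OF PiE_UNIV_Sigma, of ?f] by (simp add: comp_def)
qed

section \<open>Binomial series with exponent 1/2\<close>

lemma half_diff_of_nat_nonzero: "1/2 - of_nat k \<noteq> (0::complex)"
proof
  assume "1/2 - of_nat k = (0::complex)"
  then have "of_nat (2 * k) = (of_nat 1 :: complex)" by (simp add: field_simps)
  then have "2 * k = 1" by (simp only: of_nat_eq_iff)
  then show False by presburger
qed

text \<open>Consecutive coefficients have the ratio (1/2 - M)/(M + 1), of modulus at most 1.\<close>

lemma norm_half_gchoose_le: "norm ((1/2 :: complex) gchoose M) \<le> 1"
proof (induction M)
  case (Suc M)
  have "norm ((1/2 - of_nat M) / of_nat (Suc M) :: complex) = \<bar>1/2 - real M\<bar> / real (Suc M)"
  proof -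
    have "(1/2 - of_nat M) / of_nat (Suc M) = complex_of_real ((1/2 - real M) / real (Suc M))" by simp
    then show ?thesis by (simp only: norm_of_real) (simp add: abs_divide)
  qed
  also have "\<dots> \<le> 1" by (simp add: field_simps abs_if)
  finally have 1: "norm ((1/2 - of_nat M) / of_nat (Suc M) :: complex) \<le> 1" .
  have "norm ((1/2 :: complex) gchoose Suc M)
      = norm ((1/2 :: complex) gchoose M) * norm ((1/2 - of_nat M) / of_nat (Suc M) :: complex)"
    unfolding norm_mult [symmetric]
    by (rule arg_cong[where f = norm]) (simp add: gbinomial_prod_rev prod.atLeast0_lessThan_Suc field_simps)
  also have "\<dots> \<le> 1" using Suc 1 by (intro mult_le_one) auto
  finally show ?case .
qed simp

lemma csqrt_binomial_series:
  assumes "norm x < 1"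
  shows "(\<lambda>M. ((1/2) gchoose M) * (- 1) ^ M * x ^ M) sums csqrt (1 - x)"
  using gen_binomial_complex[of "-x" "1/2"] assms
  by (simp add: csqrt_conv_powr power_minus [of x] mult_ac)

section \<open>Integrals of a square root along paths\<close>

text \<open>Only continuity of \<open>\<eta>\<close> is assumed. Near \<open>t\<close> it equals
  \<open>\<eta> t\<close> times the principal root of \<open>h\<close>, and \<open>h\<close> is 1 at
  \<open>t\<close>, away from the branch cut.\<close>

lemma has_vector_derivative_sqrt:
  fixes \<eta> \<gamma> :: "real \<Rightarrow> complex"
  assumes \<gamma>: "(\<gamma> has_vector_derivative d) (at t)" and \<eta>: "isCont \<eta> t" and nz: "\<eta> t \<noteq> 0"
    and sq: "eventually (\<lambda>s. (\<eta> s)\<^sup>2 = a - \<gamma> s) (nhds t)"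
  shows "(\<eta> has_vector_derivative (- d / (2 * \<eta> t))) (at t)"
proof -
  define h where "h = (\<lambda>s. (a - \<gamma> s) / (\<eta> t)\<^sup>2)"
  have sqt: "(\<eta> t)\<^sup>2 = a - \<gamma> t" using sq by (rule eventually_nhds_x_imp_x)
  then have ht: "h t = 1" using nz unfolding h_def by (metis divide_self power_not_zero)
  have h: "(h has_vector_derivative (- d / (\<eta> t)\<^sup>2)) (at t)"
    unfolding h_def by (auto intro!: derivative_eq_intros \<gamma>)
  have "(csqrt has_field_derivative (inverse (2 * csqrt (h t)))) (at (h t))"
    by (rule has_field_derivative_csqrt) (simp add: ht complex_nonpos_Reals_iff)
  then have "((csqrt \<circ> h) has_vector_derivative (- d / (\<eta> t)\<^sup>2 * inverse (2 * csqrt (h t)))) (at t)"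
    by (rule field_vector_diff_chain_at[OF h])
  then have "((\<lambda>s. \<eta> t * (csqrt \<circ> h) s) has_vector_derivative
      (\<eta> t * (- d / (\<eta> t)\<^sup>2 * inverse (2 * csqrt (h t))))) (at t)"
    by (rule has_vector_derivative_mult_right)
  moreover have "\<eta> t * (- d / (\<eta> t)\<^sup>2 * inverse (2 * csqrt (h t))) = - d / (2 * \<eta> t)"
    using nz by (simp add: ht power2_eq_square field_simps)
  ultimately have *: "((\<lambda>s. \<eta> t * (csqrt \<circ> h) s) has_vector_derivative (- d / (2 * \<eta> t))) (at t)"
    by simp
  have "isCont (\<lambda>s. Re (\<eta> s / \<eta> t)) t" using \<eta> nz unfolding isCont_def by (intro tendsto_intros)
  then have "((\<lambda>s. Re (\<eta> s / \<eta> t)) \<longlongrightarrow> 1) (nhds t)"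
    using nz by (simp add: isCont_def tendsto_nhds_iff)
  \<comment> \<open>Continuity keeps \<open>\<eta> s / \<eta> t\<close> in the right half-plane,
    where it is the principal root of its own square \<open>h s\<close>.\<close>
  then have "eventually (\<lambda>s. Re (\<eta> s / \<eta> t) > 0) (nhds t)"
    by (rule order_tendstoD) simp
  with sq have ev: "eventually (\<lambda>s. \<eta> t * (csqrt \<circ> h) s = \<eta> s) (nhds t)"
  proof eventually_elim
    case (elim s)
    have "h s = (\<eta> s / \<eta> t)\<^sup>2" using elim by (simp add: h_def power_divide)
    then have "csqrt (h s) = \<eta> s / \<eta> t" using elim by (simp add: csqrt_square)
    then show ?case using nz by simp
  qed
  show ?thesis
    using * has_vector_derivative_cong_ev[of UNIV "\<lambda>s. \<eta> t * (csqrt \<circ> h) s" \<eta> t]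
      ev eventually_nhds_x_imp_x[OF ev] by (simp add: eventually_mono)
qed

text \<open>In the coordinate \<open>w\<close> with \<open>z = a - w\<^sup>2\<close> the form \<open>w q(z) dz\<close> becomes
  \<open>-2 w\<^sup>2 q(a - w\<^sup>2) dw\<close>, which is holomorphic and even on a star-shaped domain. So its
  integral depends only on the end values of \<open>w\<close>, however often the path winds around \<open>a\<close>.\<close>

lemma sqrt_path_primitive:
  assumes T: "open T" "convex T" "a \<in> T" and q: "q holomorphic_on T"
  obtains A :: "complex \<Rightarrow> complex" where "\<forall>w. A (- w) = - A w"
    and "\<forall>\<alpha> \<beta> \<gamma> \<gamma>' \<eta> S. \<alpha> \<le> \<beta> \<longrightarrow> finite S \<longrightarrow> continuous_on {\<alpha>..\<beta>} \<eta> \<longrightarrow>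
       (\<forall>t\<in>{\<alpha>..\<beta>}. \<gamma> t \<in> T) \<longrightarrow> (\<forall>t\<in>{\<alpha>..\<beta>}. (\<eta> t)\<^sup>2 = a - \<gamma> t) \<longrightarrow>
       (\<forall>t\<in>{\<alpha><..<\<beta>} - S. \<eta> t \<noteq> 0 \<and> (\<gamma> has_vector_derivative \<gamma>' t) (at t)) \<longrightarrow>
       ((\<lambda>t. \<eta> t * q (\<gamma> t) * \<gamma>' t) has_integral (A (\<eta> \<beta>) - A (\<eta> \<alpha>))) {\<alpha>..\<beta>}"
proof -
  define D where "D = (\<lambda>w. a - w\<^sup>2) -` T"
  define f where "f = (\<lambda>w. - 2 * w\<^sup>2 * q (a - w\<^sup>2))"
  have D: "open D" unfolding D_def by (intro open_vimage T continuous_intros)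
  have star: "starlike D"
    unfolding starlike_def
  proof (intro bexI ballI subsetI)
    fix w z assume w: "w \<in> D" and "z \<in> closed_segment 0 w"
    then obtain s where s: "0 \<le> s" "s \<le> 1" "z = of_real s * w"
      by (auto simp: in_segment scaleR_conv_of_real)
    \<comment> \<open>Shrinking \<open>w\<close> by the factor \<open>s\<close> moves
      \<open>a - w\<^sup>2\<close> towards \<open>a\<close> along a segment, so convexity of
      \<open>T\<close> makes \<open>D\<close> star-shaped about 0.\<close>
    have "(1 - s\<^sup>2) *\<^sub>R a + s\<^sup>2 *\<^sub>R (a - w\<^sup>2) \<in> T"
      using w s T by (intro convexD) (auto simp: D_def power_le_one)
    also have "(1 - s\<^sup>2) *\<^sub>R a + s\<^sup>2 *\<^sub>R (a - w\<^sup>2) = a - z\<^sup>2"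
      by (simp add: s scaleR_conv_of_real algebra_simps power_mult_distrib)
    finally show "z \<in> D" by (simp add: D_def)
  next
    show "0 \<in> D" using T by (simp add: D_def)
  qed
  have "(q \<circ> (\<lambda>w. a - w\<^sup>2)) holomorphic_on D"
    by (rule holomorphic_on_compose_gen[OF _ q]) (auto intro!: holomorphic_intros simp: D_def)
  then have f: "f holomorphic_on D"
    unfolding f_def comp_def by (intro holomorphic_intros)
  have "\<exists>g. \<forall>x\<in>D. (g has_field_derivative f x) (at x)"
  proof (rule holomorphic_starlike_primitive[OF _ star D finite.emptyI])
    show "continuous_on D f" using f by (rule holomorphic_on_imp_continuous_on)
  qed (use f D holomorphic_on_imp_differentiable_at in auto)
  then obtain g where g: "\<And>x. x \<in> D \<Longrightarrow> (g has_field_derivative f x) (at x)" by blast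
  \<comment> \<open>Antisymmetrising keeps the derivative because \<open>f\<close> is even. Oddness
    of \<open>A\<close> will relate the two sheets.\<close>
  define A where "A = (\<lambda>w. (g w - g (- w)) / 2)"
  have A: "(A has_field_derivative f w) (at w)" if "w \<in> D" for w
  proof -
    have 1: "(g has_field_derivative f w) (at w)" using g that by blast
    have 2: "(g has_field_derivative f (- w)) (at (- w))" using g[of "- w"] that by (simp add: D_def)
    have "((\<lambda>w. g (- w)) has_field_derivative f (- w) * (-1)) (at w)"
      by (rule DERIV_chain2[where f = g and g = uminus, OF 2]) (auto intro!: derivative_eq_intros)
    then have "(A has_field_derivative (f w - f (- w) * (-1)) / 2) (at w)"
      unfolding A_def using 1 by (intro DERIV_cdivide DERIV_diff)
    then show ?thesis by (simp add: f_def mult.assoc)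
  qed
  show ?thesis
  proof (rule that)
    show "\<forall>w. A (- w) = - A w" by (simp add: A_def field_simps)
  next
    show "\<forall>\<alpha> \<beta> \<gamma> \<gamma>' \<eta> S. \<alpha> \<le> \<beta> \<longrightarrow> finite S \<longrightarrow> continuous_on {\<alpha>..\<beta>} \<eta> \<longrightarrow>
       (\<forall>t\<in>{\<alpha>..\<beta>}. \<gamma> t \<in> T) \<longrightarrow> (\<forall>t\<in>{\<alpha>..\<beta>}. (\<eta> t)\<^sup>2 = a - \<gamma> t) \<longrightarrow>
       (\<forall>t\<in>{\<alpha><..<\<beta>} - S. \<eta> t \<noteq> 0 \<and> (\<gamma> has_vector_derivative \<gamma>' t) (at t)) \<longrightarrow>
       ((\<lambda>t. \<eta> t * q (\<gamma> t) * \<gamma>' t) has_integral (A (\<eta> \<beta>) - A (\<eta> \<alpha>))) {\<alpha>..\<beta>}"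
    proof (intro allI impI)
      fix \<alpha> \<beta> :: real and \<gamma> \<gamma>' \<eta> :: "real \<Rightarrow> complex" and S :: "real set"
      assume *: "\<alpha> \<le> \<beta>" "finite S" "continuous_on {\<alpha>..\<beta>} \<eta>"
        and "\<forall>t\<in>{\<alpha>..\<beta>}. \<gamma> t \<in> T" "\<forall>t\<in>{\<alpha>..\<beta>}. (\<eta> t)\<^sup>2 = a - \<gamma> t"
        and "\<forall>t\<in>{\<alpha><..<\<beta>} - S. \<eta> t \<noteq> 0 \<and> (\<gamma> has_vector_derivative \<gamma>' t) (at t)"
      then have \<gamma>: "\<And>t. t \<in> {\<alpha>..\<beta>} \<Longrightarrow> \<gamma> t \<in> T"
        and sq: "\<And>t. t \<in> {\<alpha>..\<beta>} \<Longrightarrow> (\<eta> t)\<^sup>2 = a - \<gamma> t"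
        and d: "\<And>t. t \<in> {\<alpha><..<\<beta>} - S \<Longrightarrow> \<eta> t \<noteq> 0 \<and> (\<gamma> has_vector_derivative \<gamma>' t) (at t)"
        by auto
      have \<gamma>_eq: "\<gamma> t = a - (\<eta> t)\<^sup>2" if "t \<in> {\<alpha>..\<beta>}" for t using sq[OF that] by simp
      have \<eta>D: "\<eta> t \<in> D" if "t \<in> {\<alpha>..\<beta>}" for t using \<gamma>[OF that] \<gamma>_eq[OF that] by (simp add: D_def)
      have "((\<lambda>t. \<eta> t * q (\<gamma> t) * \<gamma>' t) has_integral ((A \<circ> \<eta>) \<beta> - (A \<circ> \<eta>) \<alpha>)) {\<alpha>..\<beta>}"
      \<comment> \<open>At the ends, where \<open>\<eta>\<close> may vanish, and on the finite set
        \<open>S\<close>, continuity of \<open>A \<circ> \<eta>\<close> is enough.\<close>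
      proof (rule fundamental_theorem_of_calculus_interior_strong[OF *(2,1)])
        have "continuous_on D A" using A by (blast intro: continuous_at_imp_continuous_on DERIV_isCont)
        then show "continuous_on {\<alpha>..\<beta>} (A \<circ> \<eta>)"
          using *(3) \<eta>D by (intro continuous_on_compose) (auto intro: continuous_on_subset)
      next
        fix t assume t: "t \<in> {\<alpha><..<\<beta>} - S"
        have ev: "eventually (\<lambda>s. s \<in> {\<alpha><..<\<beta>}) (nhds t)" using t by (intro eventually_nhds_in_open) auto
        have "isCont \<eta> t" using continuous_on_interior[OF *(3), of t] t by simp
        moreover have "eventually (\<lambda>s. (\<eta> s)\<^sup>2 = a - \<gamma> s) (nhds t)"
          using ev by eventually_elim (use sq in auto)
        ultimately have "(\<eta> has_vector_derivative (- \<gamma>' t / (2 * \<eta> t))) (at t)"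
          using d[OF t] by (intro has_vector_derivative_sqrt) auto
        from field_vector_diff_chain_at[OF this A[OF \<eta>D]]
        have "((A \<circ> \<eta>) has_vector_derivative (- \<gamma>' t / (2 * \<eta> t)) * f (\<eta> t)) (at t)" using t by simp
        moreover have "(- \<gamma>' t / (2 * \<eta> t)) * f (\<eta> t) = \<eta> t * q (\<gamma> t) * \<gamma>' t"
          using d[OF t] t by (simp add: f_def \<gamma>_eq power2_eq_square)
        ultimately show "((A \<circ> \<eta>) has_vector_derivative (\<eta> t * q (\<gamma> t) * \<gamma>' t)) (at t)" by simp
      qed
      then show "((\<lambda>t. \<eta> t * q (\<gamma> t) * \<gamma>' t) has_integral (A (\<eta> \<beta>) - A (\<eta> \<alpha>))) {\<alpha>..\<beta>}" by simp
    qed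
  qed
qed

text \<open>Substitution of \<open>t ^ N\<close> in the Beta integral, carried out on the open
  interval, where the map is injective and all bases of \<open>powr\<close> are positive.\<close>

lemma has_integral_sqrt_one_minus_power:
  fixes L N :: nat
  assumes L: "L \<ge> 1" and N: "N \<ge> 1"
  shows "((\<lambda>t::real. t ^ (L - 1) * sqrt (1 - t ^ N)) has_integral Beta (L / N) (3/2) / N) {0..1}"
proof -
  define f where "f = (\<lambda>x::real. x powr (L / N - 1) * (1 - x) powr (3/2 - 1))"
  define S where "S = {0<..<1::real}"
  have "f integrable_on S" and int: "integral S f = Beta (L / N) (3/2)"
    using has_integral_Beta_real[of "L / N" "3/2", unfolded has_integral_Icc_iff_Ioo] L N
    unfolding f_def S_def has_integral_iff by auto
  \<comment> \<open>The change of variables asks for absolute integrability, which follows here from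
    nonnegativity.\<close>
  then have abs: "f absolutely_integrable_on S"
    by (intro nonnegative_absolutely_integrable_1) (auto simp: f_def S_def)
  have img: "(\<lambda>t. t ^ N) ` S = S"
  proof safe
    fix x assume "x \<in> S"
    then show "x ^ N \<in> S" using N by (auto simp: S_def power_less_one_iff)
  next
    fix x assume "x \<in> S"
    then have "x = root N x ^ N" "root N x \<in> S" using N by (auto simp: S_def)
    then show "x \<in> (\<lambda>t. t ^ N) ` S" by blast
  qed
  have inj: "inj_on (\<lambda>t::real. t ^ N) S"
    using N by (intro inj_onI) (auto simp: S_def intro: power_eq_imp_eq_base)
  have "(\<lambda>t. \<bar>N * t ^ (N - 1)\<bar> * f (t ^ N)) absolutely_integrable_on S \<and>
      integral S (\<lambda>t. \<bar>N * t ^ (N - 1)\<bar> * f (t ^ N)) = Beta (L / N) (3/2)"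
    by (subst has_absolute_integral_change_of_variables_1')
      (use inj abs int img in \<open>auto intro!: derivative_eq_intros simp: S_def\<close>)
  then have "((\<lambda>t. \<bar>N * t ^ (N - 1)\<bar> * f (t ^ N)) has_integral Beta (L / N) (3/2)) S"
    by (simp add: has_integral_iff set_lebesgue_integral_eq_integral)
  then have "((\<lambda>t. \<bar>N * t ^ (N - 1)\<bar> * f (t ^ N) / N) has_integral Beta (L / N) (3/2) / N) S"
    by (rule has_integral_divide)
  then have "((\<lambda>t. t ^ (L - 1) * sqrt (1 - t ^ N)) has_integral Beta (L / N) (3/2) / N) S"
  proof (rule has_integral_eq[rotated])
    fix t assume t: "t \<in> S"
    have "t ^ (N - 1) * (t ^ N) powr (L / N - 1) = t powr (real (N - 1) + N * (L / N - 1))"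
      using t by (simp add: S_def powr_add powr_realpow[symmetric] powr_powr)
    also have "real (N - 1) + N * (L / N - 1) = real (L - 1)" using L N by (simp add: field_simps of_nat_diff)
    also have "t powr real (L - 1) = t ^ (L - 1)" using t by (simp add: S_def powr_realpow)
    finally have "t ^ (N - 1) * (t ^ N) powr (L / N - 1) = t ^ (L - 1)" .
    moreover have "(1 - t ^ N) powr (3/2 - 1) = sqrt (1 - t ^ N)"
      using t by (simp add: S_def powr_half_sqrt power_le_one)
    ultimately show "\<bar>N * t ^ (N - 1)\<bar> * f (t ^ N) / N = t ^ (L - 1) * sqrt (1 - t ^ N)"
      using t N by (simp add: f_def S_def)
  qed
  then show ?thesis by (simp add: S_def has_integral_Icc_iff_Ioo)
qed

section \<open>The branch point\<close>

text \<open>The polynomial quotient of \<open>s ^ n - a ^ n\<close> by \<open>s - a\<close>, written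
  as a sum so that it also makes sense at \<open>s = a\<close>.\<close>

definition hsum :: "nat \<Rightarrow> complex \<Rightarrow> complex \<Rightarrow> complex" where
  "hsum n a s = (\<Sum>i<n. s ^ i * a ^ (n - Suc i))"

lemma power_diff_hsum: "s ^ n - a ^ n = (s - a) * hsum n a s"
  using diff_power_eq_sum[of s "n - 1" a] by (cases n) (simp_all add: hsum_def)

lemma holomorphic_on_hsum [holomorphic_intros]: "hsum n a holomorphic_on S"
  unfolding hsum_def by (intro holomorphic_intros)

lemma norm_hsum_le:
  assumes "norm a \<le> 2" "norm s \<le> 2" "n \<le> N"
  shows "norm (hsum n a s) \<le> real N * 2 ^ N"
proof -
  have "norm (hsum n a s) \<le> (\<Sum>i<n. norm (s ^ i * a ^ (n - Suc i)))"
    unfolding hsum_def by (rule norm_sum)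
  also have "\<dots> \<le> (\<Sum>i<n. 2 ^ N)"
  proof (rule sum_mono)
    fix i assume i: "i \<in> {..<n}"
    have "norm (s ^ i * a ^ (n - Suc i)) \<le> 2 ^ i * 2 ^ (n - Suc i)"
      unfolding norm_mult norm_power by (intro mult_mono power_mono assms) auto
    also have "\<dots> = 2 ^ (n - 1)" using i by (simp add: power_add [symmetric])
    also have "\<dots> \<le> 2 ^ N" using assms by (intro power_increasing) auto
    finally show "norm (s ^ i * a ^ (n - Suc i)) \<le> 2 ^ N" .
  qed
  also have "\<dots> \<le> real N * 2 ^ N" using assms by simp
  finally show ?thesis .
qed

definition spoly :: "nat \<Rightarrow> (nat \<Rightarrow> complex) \<Rightarrow> complex \<Rightarrow> complex" where
  "spoly N b s = 1 - s ^ N - (\<Sum>n=1..N-2. b n * s ^ n)"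

text \<open>For a root \<open>a\<close> of \<open>spoly N b\<close> this is the cofactor of
  \<open>a - s\<close>. Its principal square root will be the nonvanishing factor of
  \<open>y\<close>.\<close>

definition squot :: "nat \<Rightarrow> (nat \<Rightarrow> complex) \<Rightarrow> complex \<Rightarrow> complex \<Rightarrow> complex" where
  "squot N b a s = hsum N a s + (\<Sum>n=1..N-2. b n * hsum n a s)"

lemma spoly_diff: "spoly N b s - spoly N b a = (a - s) * squot N b a s"
proof -
  have "spoly N b s - spoly N b a
      = - (s ^ N - a ^ N) - (\<Sum>n=1..N-2. b n * (s ^ n - a ^ n))"
    by (simp add: spoly_def sum_subtractf right_diff_distrib)
  also have "\<dots> = (a - s) * squot N b a s"
    by (simp only: power_diff_hsum) (simp add: squot_def sum_distrib_left algebra_simps sum_subtractf)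
  finally show ?thesis .
qed

text \<open>A neighbourhood of the segment [0,1], written as a sum of two convex sets so that
  openness and convexity are immediate.\<close>

definition tube :: "real \<Rightarrow> complex set" where
  "tube \<rho> = (\<Union>x\<in>closed_segment 0 1. \<Union>e\<in>ball 0 \<rho>. {x + e})"

lemma tube_iff: "s \<in> tube \<rho> \<longleftrightarrow> (\<exists>x\<in>{0..1}. dist s (of_real x) < \<rho>)"
proof -
  have "s \<in> tube \<rho> \<longleftrightarrow> (\<exists>x\<in>closed_segment 0 1. dist s x < \<rho>)"
  proof -
    have "(\<exists>e\<in>ball 0 \<rho>. s = x + e) \<longleftrightarrow> dist s x < \<rho>" for x
      by (auto simp: dist_norm norm_minus_commute intro!: bexI[of _ "s - x"])
    then show ?thesis unfolding tube_def by auto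
  qed
  also have "closed_segment 0 1 = complex_of_real ` {0..1}"
    using closed_segment_of_real[of 0 1] by (simp add: closed_segment_eq_real_ivl)
  finally show ?thesis by simp
qed

lemma open_tube: "open (tube \<rho>)"
  unfolding tube_def by (intro open_sums) auto

lemma convex_tube: "convex (tube \<rho>)"
  unfolding tube_def by (intro convex_sums) auto

lemma segment_tube: "\<lbrakk>0 < \<rho>; x \<in> {0..1}\<rbrakk> \<Longrightarrow> of_real x \<in> tube \<rho>"
  by (auto simp: tube_iff intro!: bexI[of _ x])

lemma ball_subset_tube: "ball 1 \<rho> \<subseteq> tube \<rho>"
  by (auto simp: tube_iff dist_commute intro!: bexI[of _ 1])

lemma norm_tube_le: "s \<in> tube \<rho> \<Longrightarrow> norm s \<le> 1 + \<rho>"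
proof -
  assume "s \<in> tube \<rho>"
  then obtain x where "x \<in> {0..1}" "dist s (of_real x) < \<rho>" by (auto simp: tube_iff)
  then show ?thesis using norm_triangle_ineq2[of s "of_real x"] by (simp add: dist_norm)
qed

text \<open>Positive real part rules out further branch points in the tube and makes the principal
  root of the cofactor holomorphic. The margin 1/2 leaves room for the perturbation by the
  \<open>b n\<close>.\<close>

locale hsum_tube =
  fixes N :: nat and \<rho> :: real
  assumes N_pos: "N \<ge> 1" and \<rho>_pos: "0 < \<rho>" and \<rho>_le: "\<rho> \<le> 1"
    and hsum_pos: "\<And>s a. \<lbrakk>s \<in> tube \<rho>; a \<in> ball 1 \<rho>\<rbrakk> \<Longrightarrow> Re (hsum N a s) > 1/2"

text \<open>For \<open>a = 1\<close> and \<open>x\<close> on the segment the quotient is 1 + x + ...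
  + x^(N-1), at least 1. Compactness of the segment extends a weaker bound to nearby pairs of
  \<open>s\<close> and \<open>a\<close>.\<close>

lemma ex_hsum_tube:
  assumes "N \<ge> 1"
  shows "\<exists>\<rho>. hsum_tube N \<rho>"
proof -
  define U where "U = {p. Re (hsum N (snd p) (fst p)) > 1/2}"
  define C where "C = closed_segment 0 (1::complex) \<times> {1::complex}"
  have "C \<subseteq> U"
  proof
    fix p assume "p \<in> C"
    then obtain x where x: "x \<in> {0..1}" "p = (of_real x, 1)"
      by (auto simp: C_def in_segment scaleR_conv_of_real)
    have "Re (hsum N 1 (of_real x)) = (\<Sum>i<N. x ^ i)"
      by (simp add: hsum_def flip: of_real_power)
    moreover have "(\<Sum>i<N. x ^ i) \<ge> x ^ 0"
      using assms x by (intro member_le_sum) auto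
    ultimately show "p \<in> U" by (simp add: U_def x)
  qed
  moreover have "compact C" unfolding C_def by (intro compact_Times) auto
  moreover have "open U" unfolding U_def hsum_def
    by (intro open_Collect_less continuous_intros)
  ultimately obtain \<epsilon> where \<epsilon>: "\<epsilon> > 0" "(\<Union>p\<in>C. ball p \<epsilon>) \<subseteq> U"
    by (metis compact_subset_open_imp_ball_epsilon_subset)
  \<comment> \<open>Half of \<open>\<epsilon>\<close>, because the distances in \<open>s\<close> and
    in \<open>a\<close> add up; at most 1, so that points of the tube have norm at most 2.\<close>
  define \<rho> where "\<rho> = min 1 (\<epsilon> / 2)"
  have "hsum_tube N \<rho>"
  proof
    fix s a :: complex assume s: "s \<in> tube \<rho>" and a: "a \<in> ball 1 \<rho>"
    obtain x where x: "x \<in> {0..1}" "dist s (of_real x) < \<rho>" using s by (auto simp: tube_iff)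
    have "dist (complex_of_real x, 1) (s, a) \<le> dist s (of_real x) + dist 1 a"
      unfolding dist_Pair_Pair by (rule order_trans[OF sqrt_sum_squares_le_sum]) (auto simp: dist_commute)
    also have "\<dots> < \<epsilon>" using x a by (simp add: \<rho>_def min_def split: if_splits)
    finally have "(s, a) \<in> (\<Union>p\<in>C. ball p \<epsilon>)"
      using x by (force simp: C_def in_segment scaleR_conv_of_real)
    with \<epsilon> have "(s, a) \<in> U" by blast
    then show "Re (hsum N a s) > 1/2" by (simp add: U_def)
  qed (use assms \<epsilon> in \<open>auto simp: \<rho>_def\<close>)
  then show ?thesis ..
qed

lemma norm_sum_mult_le:
  fixes b X :: "nat \<Rightarrow> complex"
  assumes "\<And>n. n \<in> {1..N-2} \<Longrightarrow> norm (b n) \<le> \<delta>" "\<And>n. n \<in> {1..N-2} \<Longrightarrow> norm (X n) \<le> C" "0 \<le> C" "0 \<le> \<delta>"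
  shows "norm (\<Sum>n=1..N-2. b n * X n) \<le> real N * (\<delta> * C)"
proof -
  have "norm (\<Sum>n=1..N-2. b n * X n) \<le> (\<Sum>n=1..N-2. norm (b n * X n))" by (rule norm_sum)
  also have "\<dots> \<le> (\<Sum>n=1..N-2. \<delta> * C)"
    unfolding norm_mult using assms by (intro sum_mono mult_mono) auto
  also have "\<dots> \<le> real N * (\<delta> * C)" using assms by (simp add: mult_right_mono)
  finally show ?thesis .
qed

section \<open>Small perturbations: positive cofactor and a root near 1\<close>

context hsum_tube
begin

lemma norm_le_2: "s \<in> tube \<rho> \<Longrightarrow> norm s \<le> 2"
  using norm_tube_le[of s \<rho>] \<rho>_le by simp

lemma squot_pos:
  assumes "\<And>n. n \<in> {1..N-2} \<Longrightarrow> norm (b n) \<le> \<delta>" "0 \<le> \<delta>" "real N * (\<delta> * (real N * 2 ^ N)) \<le> 1/4"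
    and s: "s \<in> tube \<rho>" and a: "a \<in> ball 1 \<rho>"
  shows "Re (squot N b a s) > 0"
proof -
  have "norm (\<Sum>n=1..N-2. b n * hsum n a s) \<le> real N * (\<delta> * (real N * 2 ^ N))"
    using assms(1,2) s subsetD[OF ball_subset_tube a]
    by (intro norm_sum_mult_le norm_hsum_le norm_le_2) auto
  then have "\<bar>Re (\<Sum>n=1..N-2. b n * hsum n a s)\<bar> \<le> 1/4"
    using abs_Re_le_cmod assms(3) by (meson order_trans)
  with hsum_pos[OF s a] show ?thesis by (simp add: squot_def)
qed

text \<open>Minimum modulus principle: on the circle of radius \<open>r\<close> about 1 the modulus
  is at least r/2 - r/8, whereas at the centre it is at most r/8.\<close>

lemma ex_root:
  assumes r: "0 < r" "r < \<rho>" and b: "\<And>n. n \<in> {1..N-2} \<Longrightarrow> norm (b n) \<le> \<delta>" "0 \<le> \<delta>"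
    and small: "real N * (\<delta> * 2 ^ N) \<le> r / 8"
  obtains a where "a \<in> ball 1 r" "spoly N b a = 0"
proof (rule holomorphic_contract_to_zero[of 1 r "spoly N b"])
  show "continuous_on (cball 1 r) (spoly N b)" "spoly N b holomorphic_on ball 1 r"
    unfolding spoly_def by (intro continuous_intros holomorphic_intros)+
  fix z :: complex assume z: "norm (1 - z) = r"
  then have zT: "z \<in> tube \<rho>" using r ball_subset_tube[of \<rho>] by (auto simp: dist_norm)
  have le: "norm (\<Sum>n=1..N-2. b n * s ^ n) \<le> r / 8" if "norm s \<le> 2" for s :: complex
  proof -
    have "norm (s ^ n) \<le> 2 ^ N" if "n \<in> {1..N-2}" for n
    proof -
      have "norm (s ^ n) \<le> 2 ^ n" using \<open>norm s \<le> 2\<close> by (simp add: norm_power power_mono)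
      also have "\<dots> \<le> 2 ^ N" using that by (intro power_increasing) auto
      finally show ?thesis .
    qed
    then have "norm (\<Sum>n=1..N-2. b n * s ^ n) \<le> real N * (\<delta> * 2 ^ N)"
      by (intro norm_sum_mult_le b) auto
    with small show ?thesis by linarith
  qed
  have "norm (spoly N b 1) \<le> r / 8" using le[of 1] by (simp add: spoly_def norm_minus_cancel)
  moreover have "r / 2 \<le> norm ((1 - z) * hsum N 1 z)"
    using hsum_pos[OF zT, of 1] \<rho>_pos r complex_Re_le_cmod[of "hsum N 1 z"] by (simp add: norm_mult z)
  moreover have "spoly N b z = (1 - z) * hsum N 1 z - (\<Sum>n=1..N-2. b n * z ^ n)"
    using power_diff_hsum[of z N 1] by (simp add: spoly_def algebra_simps)
  moreover have "norm (\<Sum>n=1..N-2. b n * z ^ n) \<le> r / 8" using zT by (intro le norm_le_2)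
  ultimately show "norm (spoly N b 1) < norm (spoly N b z)"
    using r norm_triangle_ineq2[of "(1 - z) * hsum N 1 z" "\<Sum>n=1..N-2. b n * z ^ n"] by simp
qed (use r that in auto)

end

section \<open>Loop integrals\<close>

context hsum_tube
begin

text \<open>The lift to the double cover of a loop based at \<open>0\<close> that encircles the branch point \<open>1\<close>:
  in the coordinate \<open>w\<close> with \<open>s = 1 - w\<^sup>2\<close> it is an arc from \<open>-1\<close> to \<open>1\<close> that avoids \<open>0\<close>.
  Thus \<open>ly\<close>, the lift of \<open>y\<close>, starts at the negative of its end value.\<close>

definition height :: real where "height = \<rho> / 4"

definition lw :: "real \<Rightarrow> complex" where
  "lw u = of_real u + \<i> * of_real (height * (1 - u\<^sup>2))"

definition lw' :: "real \<Rightarrow> complex" where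
  "lw' u = 1 - \<i> * of_real (2 * height * u)"

definition ls :: "real \<Rightarrow> complex" where
  "ls u = 1 - (lw u)\<^sup>2"

definition ls' :: "real \<Rightarrow> complex" where
  "ls' u = - 2 * lw u * lw' u"

definition ly :: "real \<Rightarrow> complex" where
  "ly u = lw u * csqrt (hsum N 1 (ls u))"

lemma lw_ends [simp]: "lw 1 = 1" "lw (-1) = -1"
  by (simp_all add: lw_def)

lemma ls_ends [simp]: "ls 1 = 0" "ls (-1) = 0"
  by (simp_all add: ls_def)

lemma lw_nz: "lw u \<noteq> 0"
proof
  assume "lw u = 0"
  then have "Re (lw u) = 0" "Im (lw u) = 0" by simp_all
  then show False using \<rho>_pos by (simp add: lw_def height_def)
qed

lemma has_vector_derivative_lw: "(lw has_vector_derivative lw' u) (at u within X)"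
  unfolding lw_def lw'_def
  by (rule derivative_eq_intros refl | simp add: complex_eq_iff)+

lemma has_vector_derivative_ls: "(ls has_vector_derivative ls' u) (at u within X)"
  unfolding ls_def ls'_def power2_eq_square
  by (rule derivative_eq_intros has_vector_derivative_lw refl | simp add: algebra_simps)+

lemma continuous_on_lw: "continuous_on X lw"
  by (auto intro!: continuous_on_vector_derivative has_vector_derivative_lw)

lemma continuous_on_ls: "continuous_on X ls"
  by (auto intro!: continuous_on_vector_derivative has_vector_derivative_ls)

lemma continuous_on_ls': "continuous_on X ls'"
  unfolding ls'_def lw'_def by (intro continuous_intros continuous_on_lw)

lemma ls_tube:
  assumes "u \<in> {-1..1}"
  shows "ls u \<in> tube \<rho>"
proof -
  define h where "h = height * (1 - u\<^sup>2)"
  have u1: "\<bar>u\<bar> \<le> 1" using assms by auto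
  then have u: "u\<^sup>2 \<le> 1" "\<bar>u\<bar> \<le> 1" by (simp_all only: abs_square_le_1)
  have "0 \<le> h" "h \<le> \<rho> / 4"
    using u \<rho>_pos mult_left_mono[of "1 - u\<^sup>2" 1 "\<rho> / 4"] by (auto simp: h_def height_def)
  \<comment> \<open>The point \<open>1 - u\<^sup>2\<close> lies on the segment. The difference has
    norm at most \<open>3 * h\<close>, which the factor 1/4 in \<open>height\<close> keeps below
    \<open>\<rho>\<close>.\<close>
  have "ls u - of_real (1 - u\<^sup>2) = of_real (h\<^sup>2) - \<i> * of_real (2 * u * h)"
    by (simp add: ls_def lw_def flip: h_def) (simp add: complex_eq_iff power2_eq_square)
  then have "norm (ls u - of_real (1 - u\<^sup>2)) \<le> h\<^sup>2 + \<bar>2 * u * h\<bar>"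
    by (metis norm_triangle_ineq4 norm_mult norm_ii mult_1 norm_of_real abs_power2)
  also have "\<dots> \<le> h + 2 * h"
  proof (rule add_mono)
    show "h\<^sup>2 \<le> h"
      using \<open>0 \<le> h\<close> \<open>h \<le> \<rho> / 4\<close> \<rho>_le mult_left_mono[of h 1 h] by (simp add: power2_eq_square)
    show "\<bar>2 * u * h\<bar> \<le> 2 * h"
      using \<open>0 \<le> h\<close> u mult_right_mono[of "\<bar>u\<bar>" 1 h] by (simp add: abs_mult)
  qed
  also have "\<dots> < \<rho>" using \<open>h \<le> \<rho> / 4\<close> \<rho>_pos by simp
  finally show ?thesis using u by (auto simp: tube_iff dist_norm intro!: bexI[of _ "1 - u\<^sup>2"])
qed

lemma Re_hsum_ls: "u \<in> {-1..1} \<Longrightarrow> Re (hsum N 1 (ls u)) > 1/2"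
  using ls_tube \<rho>_pos by (intro hsum_pos) auto

lemma holomorphic_csqrt_hsum: "(\<lambda>s. csqrt (hsum N 1 s)) holomorphic_on tube \<rho>"
proof (intro holomorphic_intros)
  fix s assume "s \<in> tube \<rho>"
  then show "hsum N 1 s \<notin> \<real>\<^sub>\<le>\<^sub>0"
    using hsum_pos[of s 1] \<rho>_pos by (auto simp: complex_nonpos_Reals_iff)
qed

lemma continuous_on_ly: "continuous_on {-1..1} ly"
proof -
  have "continuous_on {-1..1} (\<lambda>u. csqrt (hsum N 1 (ls u)))"
    using continuous_on_compose2[OF holomorphic_on_imp_continuous_on[OF holomorphic_csqrt_hsum]
      continuous_on_ls] ls_tube by blast
  then show ?thesis unfolding ly_def by (intro continuous_intros continuous_on_lw)
qed

lemma ly_sq: "(ly u)\<^sup>2 = 1 - ls u ^ N"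
  using power_diff_hsum[of "ls u" N 1] by (simp add: ly_def power_mult_distrib ls_def algebra_simps)

lemma ly_nz: "u \<in> {-1..1} \<Longrightarrow> ly u \<noteq> 0"
  using Re_hsum_ls[of u] lw_nz by (auto simp: ly_def)

lemma ly_ends [simp]: "ly 1 = 1" "ly (-1) = -1"
proof -
  have "hsum N 1 0 = 1" using power_diff_hsum[of 0 N 1] N_pos by (simp add: power_0_left)
  then show "ly 1 = 1" "ly (-1) = -1" by (simp_all add: ly_def)
qed

text \<open>Differentiates \<open>ly\<close> as a continuous square root of
  \<open>1 - ls u ^ N\<close>, with \<open>ls u ^ N\<close> in the role of the path and
  \<open>a = 1\<close>.\<close>

lemma has_vector_derivative_ly:
  assumes u: "u \<in> {-1<..<1}"
  shows "(ly has_vector_derivative (- (of_nat N * ls u ^ (N - 1) * ls' u) / (2 * ly u))) (at u)"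
proof (rule has_vector_derivative_sqrt[where a = 1])
  show "((\<lambda>u. ls u ^ N) has_vector_derivative of_nat N * ls u ^ (N - 1) * ls' u) (at u)"
  proof -
    have "((\<lambda>z. z ^ N) has_field_derivative of_nat N * ls u ^ (N - 1)) (at (ls u))"
      by (auto intro!: derivative_eq_intros)
    from field_vector_diff_chain_at[OF has_vector_derivative_ls this]
    show ?thesis by (simp add: comp_def mult_ac)
  qed
  show "isCont ly u" using continuous_on_interior[OF continuous_on_ly] u by simp
  show "ly u \<noteq> 0" using u by (intro ly_nz) auto
  show "eventually (\<lambda>u. (ly u)\<^sup>2 = 1 - ls u ^ N) (nhds u)" by (simp add: ly_sq)
qed

text \<open>The form s^(L-1) (1 - s^N)^(1/2 - M) ds pulled back to the loop; \<open>ly\<close>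
  supplies the half power on the continued branch.\<close>

definition lint :: "nat \<Rightarrow> nat \<Rightarrow> real \<Rightarrow> complex" where
  "lint M L u = ls u ^ (L - 1) / (1 - ls u ^ N) ^ M * ly u * ls' u"

lemma ls_pow_nz: "u \<in> {-1..1} \<Longrightarrow> 1 - ls u ^ N \<noteq> 0"
  using ly_nz ly_sq by (metis power_not_zero)

lemma continuous_on_lint: "continuous_on {-1..1} (lint M L)"
  unfolding lint_def
  by (intro continuous_intros continuous_on_ls continuous_on_ly continuous_on_ls') (use ls_pow_nz in auto)

text \<open>One odd primitive \<open>A\<close> in the coordinate \<open>w\<close> serves both
  curves. The segment, with \<open>w\<close> from 1 to 0, gives \<open>- A 1\<close>, which is the
  Beta integral; the loop, with \<open>w\<close> from -1 to 1, gives \<open>2 * A 1\<close>.\<close>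

lemma has_integral_lint_0:
  assumes "L \<ge> 1"
  shows "(lint 0 L has_integral of_real (- 2 * (Beta (real L / real N) (3/2) / real N))) {-1..1}"
proof -
  let ?q = "\<lambda>s. s ^ (L - 1) * csqrt (hsum N 1 s)"
  have one: "1 \<in> tube \<rho>" using segment_tube[OF \<rho>_pos, of 1] by simp
  have q: "?q holomorphic_on tube \<rho>" by (intro holomorphic_on_mult holomorphic_csqrt_hsum holomorphic_intros)
  obtain A where odd: "\<forall>w. A (- w) = - A w"
    and A: "\<forall>\<alpha> \<beta> \<gamma> \<gamma>' \<eta> S. \<alpha> \<le> \<beta> \<longrightarrow> finite S \<longrightarrow> continuous_on {\<alpha>..\<beta>} \<eta> \<longrightarrow>
       (\<forall>t\<in>{\<alpha>..\<beta>}. \<gamma> t \<in> tube \<rho>) \<longrightarrow> (\<forall>t\<in>{\<alpha>..\<beta>}. (\<eta> t)\<^sup>2 = 1 - \<gamma> t) \<longrightarrow>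
       (\<forall>t\<in>{\<alpha><..<\<beta>} - S. \<eta> t \<noteq> 0 \<and> (\<gamma> has_vector_derivative \<gamma>' t) (at t)) \<longrightarrow>
       ((\<lambda>t. \<eta> t * ?q (\<gamma> t) * \<gamma>' t) has_integral (A (\<eta> \<beta>) - A (\<eta> \<alpha>))) {\<alpha>..\<beta>}"
    by (rule sqrt_path_primitive[OF open_tube convex_tube one q])
  have A0: "A 0 = 0" using odd[rule_format, of 0] by simp
  have "((\<lambda>t. of_real (sqrt (1 - t)) * ?q (of_real t) * 1) has_integral
      (A (of_real (sqrt (1 - 1))) - A (of_real (sqrt (1 - 0))))) {0..1}"
  proof (rule A[rule_format, where S = "{}"])
    show "continuous_on {0..1} (\<lambda>t. complex_of_real (sqrt (1 - t)))"
      by (intro continuous_intros)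
    show "(of_real (sqrt (1 - t)))\<^sup>2 = 1 - complex_of_real t" if "t \<in> {0..1}" for t
      using that by (simp flip: of_real_power)
    show "complex_of_real (sqrt (1 - t)) \<noteq> 0 \<and> (of_real has_vector_derivative (1::complex)) (at t)"
      if "t \<in> {0<..<1} - {}" for t
      using that has_vector_derivative_of_real[OF DERIV_ident] by force
  qed (use segment_tube[OF \<rho>_pos] in auto)
  then have "((\<lambda>t. of_real (sqrt (1 - t)) * ?q (of_real t)) has_integral - A 1) {0..1}"
    by (simp add: A0)
  moreover have "complex_of_real (sqrt (1 - t)) * ?q (of_real t) = of_real (t ^ (L - 1) * sqrt (1 - t ^ N))"
    if "t \<in> {0..1}" for t
  proof -
    have h: "hsum N 1 (of_real t) = complex_of_real (\<Sum>i<N. t ^ i)"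
      by (simp add: hsum_def)
    have "(1 - t) * (\<Sum>i<N. t ^ i) = 1 - t ^ N"
      by (simp add: one_diff_power_eq)
    then have "sqrt (1 - t) * sqrt (\<Sum>i<N. t ^ i) = sqrt (1 - t ^ N)"
      by (simp flip: real_sqrt_mult)
    then show ?thesis
      using that by (simp add: h sum_nonneg mult_ac flip: of_real_mult of_real_power of_real_sum)
  qed
  ultimately have "((\<lambda>t. complex_of_real (t ^ (L - 1) * sqrt (1 - t ^ N))) has_integral - A 1) {0..1}"
    by (rule has_integral_eq[rotated]) auto
  moreover have "((\<lambda>t. complex_of_real (t ^ (L - 1) * sqrt (1 - t ^ N))) has_integral
      of_real (Beta (real L / real N) (3/2) / real N)) {0..1}"
    using has_integral_linear[OF has_integral_sqrt_one_minus_power[OF assms N_pos] bounded_linear_of_real]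
    by (simp only: comp_def)
  ultimately have A1: "- A 1 = of_real (Beta (real L / real N) (3/2) / real N)"
    by (rule has_integral_unique)
  have "((\<lambda>u. lw u * ?q (ls u) * ls' u) has_integral (A (lw 1) - A (lw (-1)))) {-1..1}"
  proof (rule A[rule_format, where S = "{}"])
    show "(lw u)\<^sup>2 = 1 - ls u" for u by (simp add: ls_def)
  qed (use ls_tube lw_nz has_vector_derivative_ls in \<open>auto intro!: continuous_on_lw\<close>)
  moreover have "A (lw 1) - A (lw (-1)) = of_real (- 2 * (Beta (real L / real N) (3/2) / real N))"
  proof -
    have "A 1 = - of_real (Beta (real L / real N) (3/2) / real N)" using A1 by (metis minus_minus)
    then show ?thesis using odd[rule_format, of 1] by simp
  qed
  moreover have "lint 0 L = (\<lambda>u. lw u * ?q (ls u) * ls' u)"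
    by (simp add: fun_eq_iff lint_def ly_def mult_ac)
  ultimately show ?thesis by simp
qed

text \<open>The total derivative of \<open>s\<^sup>L y (1 - s\<^sup>N)\<^sup>-\<^sup>M\<close> integrates to \<open>0\<close> over the loop. This
  continues the Beta integral to the exponents \<open>1/2 - M\<close>, where the integral over the segment
  diverges.\<close>

lemma has_integral_lint_Suc:
  assumes L: "L \<ge> 1" and J: "(lint M L has_integral J) {-1..1}"
  shows "(lint (Suc M) L has_integral
    ((of_nat L / of_nat N + 1/2 - of_nat M) / (1/2 - of_nat M) * J)) {-1..1}"
proof -
  define F where "F = (\<lambda>u. ls u ^ L * ly u / (1 - ls u ^ N) ^ M)"
  \<comment> \<open>In the derivative of \<open>F\<close>, writing s^N as 1 - (1 - s^N) leaves a
    combination of the integrands of orders \<open>M\<close> and \<open>Suc M\<close>, the latter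
    with coefficient \<open>- c\<close>.\<close>
  define c where "c = (1/2 - of_nat M) * (of_nat N :: complex)"
  note half = half_diff_of_nat_nonzero[of M]
  have c: "c \<noteq> 0" using N_pos half by (simp add: c_def)
  have "((\<lambda>u. (of_nat L + c) * lint M L u - c * lint (Suc M) L u) has_integral (F 1 - F (-1))) {-1..1}"
  proof (rule fundamental_theorem_of_calculus_interior)
    show "continuous_on {-1..1} F"
      unfolding F_def by (intro continuous_intros continuous_on_ls continuous_on_ly) (use ls_pow_nz in auto)
    fix u :: real assume u: "u \<in> {-1<..<1}"
    define s y d where "s = ls u" and "y = ly u" and "d = ls' u"
    have D: "1 - s ^ N \<noteq> 0" using ls_pow_nz[of u] u by (simp add: s_def)
    have y: "y \<noteq> 0" "y\<^sup>2 = 1 - s ^ N" using ly_nz[of u] u by (simp_all add: s_def y_def ly_sq)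
    have powN: "s ^ (N - 1) * s = s ^ N" using N_pos by (cases N) auto
    have powL: "s ^ L = s ^ (L - 1) * s" using L by (cases L) auto
    define p where "p = 1 - s ^ N"
    have p: "p \<noteq> 0" using D by (simp add: p_def)
    \<comment> \<open>Dividing by \<open>p\<close> avoids the truncated exponent
      \<open>M - 1\<close>; for \<open>M = 0\<close> both sides are 0.\<close>
    have pM: "of_nat M * p ^ (M - 1) = of_nat M * p ^ M / p" using p by (cases M) auto
    have "((\<lambda>z. z ^ L / (1 - z ^ N) ^ M) has_field_derivative
        (of_nat L * s ^ (L - 1) * p ^ M + s ^ L * (of_nat M * p ^ (M - 1) * (of_nat N * s ^ (N - 1))))
        / (p ^ M * p ^ M)) (at s)"
      using D by (auto intro!: derivative_eq_intros simp: power2_eq_square p_def)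
    also have "of_nat L * s ^ (L - 1) * p ^ M + s ^ L * (of_nat M * p ^ (M - 1) * (of_nat N * s ^ (N - 1)))
        = (of_nat L * p ^ M + (of_nat M * p ^ M / p) * of_nat N * s ^ N) * s ^ (L - 1)"
      unfolding pM powL powN [symmetric] by (simp add: algebra_simps)
    also have "\<dots> / (p ^ M * p ^ M)
        = (of_nat L * (1 - s ^ N) + of_nat M * of_nat N * s ^ N) * s ^ (L - 1) / (1 - s ^ N) ^ Suc M" (is "_ = ?g")
      using p by (simp add: field_simps flip: p_def)
    finally have "((\<lambda>z. z ^ L / (1 - z ^ N) ^ M) has_field_derivative ?g) (at (ls u))" by (simp add: s_def)
    from field_vector_diff_chain_at[OF has_vector_derivative_ls this]
    have "((\<lambda>u. ls u ^ L / (1 - ls u ^ N) ^ M) has_vector_derivative d * ?g) (at u)"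
      by (simp add: comp_def d_def)
    from has_vector_derivative_mult[OF this has_vector_derivative_ly[OF u]]
    have "(F has_vector_derivative
        s ^ L / (1 - s ^ N) ^ M * (- (of_nat N * s ^ (N - 1) * d) / (2 * y)) + d * ?g * y) (at u)"
      by (simp add: F_def s_def y_def d_def)
    also have "s ^ L / (1 - s ^ N) ^ M * (- (of_nat N * s ^ (N - 1) * d) / (2 * y)) + d * ?g * y
      = (of_nat L + c) * lint M L u - c * lint (Suc M) L u"
    proof -
      have "s ^ L * (- (of_nat N * s ^ (N - 1) * d) / (2 * y)) = - (of_nat N * s ^ N / 2) * s ^ (L - 1) * d * (1 / y)"
        unfolding powL powN [symmetric] by simp
      also have "1 / y = y / (1 - s ^ N)" using y(1) by (simp flip: y(2) add: power2_eq_square)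
      finally have *: "s ^ L * (- (of_nat N * s ^ (N - 1) * d) / (2 * y))
          = - (of_nat N * s ^ N / 2) * s ^ (L - 1) * d * (y / (1 - s ^ N))" .
      define E where "E = s ^ (L - 1) / (1 - s ^ N) ^ Suc M * y * d"
      have "s ^ L / (1 - s ^ N) ^ M * (- (of_nat N * s ^ (N - 1) * d) / (2 * y))
          = s ^ L * (- (of_nat N * s ^ (N - 1) * d) / (2 * y)) / (1 - s ^ N) ^ M" by simp
      also have "\<dots> = - (of_nat N * s ^ N / 2) * E"
        unfolding * by (simp add: E_def mult_ac)
      finally have 1: "s ^ L / (1 - s ^ N) ^ M * (- (of_nat N * s ^ (N - 1) * d) / (2 * y))
          = - (of_nat N * s ^ N / 2) * E" .
      have 2: "d * ?g * y = (of_nat L * (1 - s ^ N) + of_nat M * of_nat N * s ^ N) * E"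
        by (simp add: E_def)
      have 3: "lint M L u = (1 - s ^ N) * E" "lint (Suc M) L u = E"
        using D by (simp_all add: lint_def s_def y_def d_def E_def)
      show ?thesis unfolding 1 2 3 c_def by (simp add: algebra_simps)
    qed
    finally show "(F has_vector_derivative (of_nat L + c) * lint M L u - c * lint (Suc M) L u) (at u)" .
  qed auto
  \<comment> \<open>Both ends of the loop lie over \<open>s = 0\<close>, where the factor s^L
    vanishes because \<open>L\<close> is positive.\<close>
  moreover have "F 1 - F (-1) = 0" using L by (simp add: F_def)
  ultimately have "((\<lambda>u. (of_nat L + c) * lint M L u - c * lint (Suc M) L u) has_integral 0) {-1..1}" by simp
  from has_integral_diff[OF has_integral_mult_right[OF J, of "of_nat L + c"] this]
  have "((\<lambda>u. c * lint (Suc M) L u) has_integral ((of_nat L + c) * J)) {-1..1}" by simp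
  from has_integral_mult_right[OF this, of "1 / c"]
  have "(lint (Suc M) L has_integral ((of_nat L + c) / c * J)) {-1..1}" using c by simp
  moreover have "(of_nat L + c) / c = (of_nat L / of_nat N + 1/2 - of_nat M) / (1/2 - of_nat M)"
    using N_pos half c by (simp add: c_def divide_simps) (simp add: algebra_simps)
  ultimately show ?thesis by simp
qed

lemma has_integral_lint:
  assumes L: "L \<ge> 1"
  shows "(lint M L has_integral
    ((\<Prod>k<M. (of_nat L / of_nat N + 1/2 - of_nat k) / (1/2 - of_nat k))
      * of_real (- 2 * (Beta (real L / real N) (3/2) / real N)))) {-1..1}"
proof (induction M)
  case 0
  show ?case using has_integral_lint_0[OF L] by simp
next
  case (Suc M)
  show ?case using has_integral_lint_Suc[OF L Suc] by (simp add: mult_ac)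
qed

end

section \<open>Expansion under the loop integral\<close>

lemma gbinomial_half_fact: "((1/2 :: complex) gchoose M) * fact M = (\<Prod>k<M. 1/2 - of_nat k)"
  by (simp add: gbinomial_prod_rev lessThan_atLeast0)

text \<open>The recurrence of the entire function \<open>rGamma\<close> has no exceptional points,
  so arguments at non-positive integers are covered.\<close>

lemma rGamma_diff_of_nat: "rGamma (z - of_nat M) = (\<Prod>k<M. z - 1 - of_nat k) * rGamma (z :: complex)"
proof (induction M)
  case (Suc M)
  have "rGamma (z - of_nat (Suc M)) = (z - of_nat (Suc M)) * rGamma (z - of_nat (Suc M) + 1)"
    by (rule rGamma_plus1 [symmetric])
  also have "z - of_nat (Suc M) + 1 = z - of_nat M" by simp
  finally show ?case by (simp add: Suc algebra_simps)
qed simp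

lemma Gamma_three_halves: "Gamma (3/2 :: real) = sqrt pi / 2"
proof -
  have "(1/2 :: real) \<notin> \<int>\<^sub>\<le>\<^sub>0" using nonpos_Ints_nonpos[of "1/2 :: real"] by auto
  from Gamma_plus1[OF this] show ?thesis by (simp add: Gamma_one_half_real)
qed

text \<open>The factorial of \<open>M\<close> turns the binomial coefficient into the product of the
  1/2 - k, which cancels the denominators from the recurrence. The numerators shift the reciprocal
  Gamma factor of the Beta function by \<open>M\<close>, and Gamma(3/2) supplies the root of
  pi.\<close>

lemma multinom_lint_coefficient:
  fixes N :: nat and l :: "nat \<Rightarrow> nat" and b :: "nat \<Rightarrow> complex"
  defines "M \<equiv> Msum N l" and "L \<equiv> Lsum N l"
  assumes N: "N \<ge> 1"
  shows "((1/2) gchoose M) * (- 1) ^ M * (multinom {1..N-2} l * (\<Prod>n=1..N-2. b n ^ l n)) *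
      ((\<Prod>k<M. (of_nat L / of_nat N + 1/2 - of_nat k) / (1/2 - of_nat k))
        * of_real (- 2 * (Beta (real L / real N) (3/2) / real N)))
    = - (of_real (sqrt pi) / of_nat N) * R_term N 1 b l"
proof -
  let ?P = "\<Prod>n=1..N-2. b n ^ l n" and ?F = "\<Prod>n=1..N-2. fact (l n) :: complex"
  let ?w = "of_nat L / of_nat N :: complex"
  let ?h = "\<Prod>k<M. 1/2 - of_nat k :: complex"
  have M: "sum l {1..N-2} = M" by (simp add: M_def Msum_def)
  have h: "?h \<noteq> 0" using half_diff_of_nat_nonzero by (simp only: prod_zero_iff finite_lessThan) blast
  have 1: "((1/2) gchoose M) * multinom {1..N-2} l = ?h / ?F"
    using M by (simp add: multinom_def flip: gbinomial_half_fact)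
  have 2: "(\<Prod>k<M. (?w + 1/2 - of_nat k) / (1/2 - of_nat k)) = (\<Prod>k<M. ?w + 1/2 - of_nat k) / ?h"
    by (rule prod_dividef)
  have 3: "rGamma (3/2 + ?w - of_nat M) = (\<Prod>k<M. ?w + 1/2 - of_nat k) * rGamma (3/2 + ?w)"
    by (simp add: rGamma_diff_of_nat algebra_simps)
  have 4: "complex_of_real (Beta (real L / real N) (3/2)) = of_real (sqrt pi) / 2 * (Gamma ?w * rGamma (3/2 + ?w))"
    unfolding Beta_altdef by (simp add: Gamma_three_halves add.commute flip: Gamma_complex_of_real rGamma_complex_of_real)
  have 5: "R_term N 1 b l = (-1) ^ M * (?P / ?F) * (Gamma ?w * rGamma (3/2 + ?w - of_nat M))"
    by (simp add: R_term_def M_def L_def)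
  have "((1/2) gchoose M) * (- 1) ^ M * (multinom {1..N-2} l * ?P) *
      ((\<Prod>k<M. (?w + 1/2 - of_nat k) / (1/2 - of_nat k))
        * of_real (- 2 * (Beta (real L / real N) (3/2) / real N)))
    = (((1/2) gchoose M) * multinom {1..N-2} l) * (- 1) ^ M * ?P *
      ((\<Prod>k<M. (?w + 1/2 - of_nat k) / (1/2 - of_nat k))
        * (- 2 * (of_real (Beta (real L / real N) (3/2)) / of_nat N)))" by simp
  also have "\<dots> = - (of_real (sqrt pi) / of_nat N) * R_term N 1 b l"
    unfolding 1 2 4 5 3 using h by (simp add: mult_ac)
  finally show ?thesis .
qed

context hsum_tube
begin

text \<open>The loop is compact and misses the zeros of 1 - s^N. The bound does not involve the
  perturbation, so smallness of \<open>b\<close> can be measured against it.\<close>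

lemma ex_lower_bound: "\<exists>m>0. \<forall>u\<in>{-1..1}. m \<le> norm (1 - ls u ^ N)"
proof -
  have cont: "continuous_on {-1..1} (\<lambda>u. norm (1 - ls u ^ N))"
    by (intro continuous_intros continuous_on_ls)
  obtain u where u: "u \<in> {-1..1}" "\<forall>v\<in>{-1..1}. norm (1 - ls u ^ N) \<le> norm (1 - ls v ^ N)"
    using continuous_attains_inf[OF compact_Icc _ cont] by auto
  then show ?thesis using ls_pow_nz[of u] by (intro exI[of _ "norm (1 - ls u ^ N)"]) auto
qed

text \<open>The branch of the root of \<open>spoly N b\<close> along the loop: \<open>ly\<close>
  corrected by the principal root of the quotient of \<open>spoly N b\<close> by 1 - s^N, which has
  positive real part for small \<open>b\<close>.\<close>

definition lyb :: "(nat \<Rightarrow> complex) \<Rightarrow> real \<Rightarrow> complex" where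
  "lyb b u = ly u * csqrt (1 - (\<Sum>n=1..N-2. b n * ls u ^ n) / (1 - ls u ^ N))"

text \<open>Along the loop the double expansion of the root converges uniformly, so it may be
  integrated term by term.\<close>

lemma loop_integral:
  assumes m: "m > 0" "\<And>u. u \<in> {-1..1} \<Longrightarrow> m \<le> norm (1 - ls u ^ N)"
    and b: "(\<Sum>n=1..N-2. norm (b n) * 2 ^ N / m) < 1"
  obtains S where "(R_term N 1 b has_sum S) ({1..N-2} \<rightarrow>\<^sub>E UNIV)"
    and "((\<lambda>u. lyb b u * ls' u) has_integral (- (of_real (sqrt pi) / of_nat N) * S)) {-1..1}"
    and "\<And>u. u \<in> {-1..1} \<Longrightarrow> (lyb b u)\<^sup>2 = spoly N b (ls u)"
    and "continuous_on {-1..1} (lyb b)"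
    and "\<And>u. u \<in> {-1..1} \<Longrightarrow> lyb b u \<noteq> 0"
proof -
  let ?A = "{1..N-2}"
  define \<phi> where "\<phi> = (\<lambda>M. ((1/2 :: complex) gchoose M) * (- 1) ^ M)"
  define x where "x = (\<lambda>u n. b n * ls u ^ n / (1 - ls u ^ N))"
  define r where "r = (\<lambda>n. norm (b n) * 2 ^ N / m)"
  define f where "f = (\<lambda>l u. \<phi> (sum l ?A) * (multinom ?A l * (\<Prod>n\<in>?A. x u n ^ l n)) * (ly u * ls' u))"
  have \<phi>: "norm (\<phi> M) \<le> 1" for M using norm_half_gchoose_le[of M] by (simp add: \<phi>_def norm_mult norm_power)
  have x_le: "norm (x u n) \<le> r n" if u: "u \<in> {-1..1}" and n: "n \<in> ?A" for u n
  proof -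
    have "norm (ls u) ^ n \<le> 2 ^ n" using norm_le_2[OF ls_tube[OF u]] by (intro power_mono) auto
    also have "\<dots> \<le> 2 ^ N" using n by (intro power_increasing) auto
    finally show ?thesis
      unfolding x_def r_def norm_divide norm_mult norm_power using m(1) m(2)[OF u]
      by (intro frac_le mult_left_mono mult_nonneg_nonneg) auto
  qed
  have r: "sum r ?A < 1" using b by (simp add: r_def)
  have x_sum: "(\<Sum>n\<in>?A. norm (x u n)) < 1" if u: "u \<in> {-1..1}" for u
    using sum_mono[of ?A "\<lambda>n. norm (x u n)" r] x_le[OF u] r by simp
  have x_sum': "norm (\<Sum>n\<in>?A. x u n) < 1" if u: "u \<in> {-1..1}" for u
    using norm_sum[of "x u" ?A] x_sum[OF u] by linarith
  have lyb_eq: "lyb b u = ly u * csqrt (1 - (\<Sum>n\<in>?A. x u n))" for u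
    by (simp add: lyb_def x_def sum_divide_distrib)
  have Re: "Re (1 - (\<Sum>n\<in>?A. x u n)) > 0" if u: "u \<in> {-1..1}" for u
    using x_sum'[OF u] complex_Re_le_cmod[of "\<Sum>n\<in>?A. x u n"] by simp
  have sq: "(lyb b u)\<^sup>2 = spoly N b (ls u)" if u: "u \<in> {-1..1}" for u
    using ls_pow_nz[OF u] by (simp add: lyb_def power_mult_distrib ly_sq spoly_def field_simps)
  have nz: "lyb b u \<noteq> 0" if u: "u \<in> {-1..1}" for u
  proof -
    have "1 - (\<Sum>n\<in>?A. x u n) \<noteq> 0" using Re[OF u] by (metis less_irrefl zero_complex.sel(1))
    then show ?thesis using ly_nz[OF u] by (simp add: lyb_eq)
  qed
  have cont: "continuous_on {-1..1} (lyb b)"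
  proof -
    have "continuous_on {-1..1} (\<lambda>u. csqrt (1 - (\<Sum>n\<in>?A. x u n)))"
    proof (rule continuous_on_compose2[OF continuous_on_csqrt])
      show "continuous_on {-1..1} (\<lambda>u. 1 - (\<Sum>n\<in>?A. x u n))"
        unfolding x_def by (intro continuous_intros continuous_on_ls) (use ls_pow_nz in auto)
      show "(\<lambda>u. 1 - (\<Sum>n\<in>?A. x u n)) ` {-1..1} \<subseteq> - \<real>\<^sub>\<le>\<^sub>0"
      proof (intro image_subsetI ComplI)
        fix u :: real assume "u \<in> {-1..1}" "1 - (\<Sum>n\<in>?A. x u n) \<in> \<real>\<^sub>\<le>\<^sub>0"
        then show False using Re[of u] unfolding complex_nonpos_Reals_iff by linarith
      qed
    qed
    then show ?thesis unfolding lyb_eq[abs_def] by (intro continuous_intros continuous_on_ly)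
  qed
  have "compact ((\<lambda>u. ly u * ls' u) ` {-1..1})"
    by (intro compact_continuous_image continuous_intros continuous_on_ly continuous_on_ls') auto
  then have "bounded ((\<lambda>u. ly u * ls' u) ` {-1..1})" by (rule compact_imp_bounded)
  then obtain B where B: "\<And>u. u \<in> {-1..1} \<Longrightarrow> norm (ly u * ls' u) \<le> B"
    unfolding bounded_iff by blast
  define coef where "coef = (\<lambda>l. \<phi> (sum l ?A) * (multinom ?A l * (\<Prod>n\<in>?A. b n ^ l n)))"
  \<comment> \<open>Collecting powers produces the exponents \<open>Lsum N l - 1\<close> and
    \<open>Msum N l\<close>; the 1 in \<open>Lsum\<close> makes up for the exponent
    \<open>L - 1\<close> in \<open>lint\<close>.\<close>
  have f_eq: "f l u = coef l * lint (Msum N l) (Lsum N l) u" for l u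
  proof -
    have "(\<Prod>n\<in>?A. x u n ^ l n)
        = (\<Prod>n\<in>?A. b n ^ l n) * (\<Prod>n\<in>?A. ls u ^ (n * l n)) / (\<Prod>n\<in>?A. (1 - ls u ^ N) ^ l n)"
      by (simp add: x_def power_divide power_mult_distrib power_mult prod.distrib prod_dividef)
    also have "\<dots> = (\<Prod>n\<in>?A. b n ^ l n) * ls u ^ (Lsum N l - 1) / (1 - ls u ^ N) ^ Msum N l"
      by (simp add: Lsum_def Msum_def power_sum)
    finally show ?thesis by (simp add: f_def coef_def lint_def)
  qed
  have lim: "uniform_limit {-1..1} (\<lambda>X u. \<Sum>l\<in>X. f l u) (\<lambda>u. lyb b u * ls' u)
      (finite_subsets_at_top (?A \<rightarrow>\<^sub>E UNIV))"
  \<comment> \<open>The majorant is the multinomial family of the constants \<open>r n\<close>,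
    independent of \<open>u\<close>, times a bound \<open>B\<close> for
    \<open>ly u * ls' u\<close>.\<close>
  proof (rule Weierstrass_m_test_general')
    fix l :: "nat \<Rightarrow> nat" and u :: real assume u: "u \<in> {-1..1}"
    have "norm (f l u) = norm (\<phi> (sum l ?A)) * (multinom ?A l * (\<Prod>n\<in>?A. norm (x u n) ^ l n)) * norm (ly u * ls' u)"
      by (simp add: f_def norm_mult prod_norm [symmetric] norm_power)
    also have "\<dots> \<le> 1 * (multinom ?A l * (\<Prod>n\<in>?A. r n ^ l n)) * B"
      using u by (intro mult_mono \<phi> B order_refl prod_mono conjI power_mono x_le
        mult_nonneg_nonneg multinom_nonneg prod_nonneg) (use order_trans[OF norm_ge_zero x_le[OF u]] in auto)
    finally show "norm (f l u) \<le> multinom ?A l * (\<Prod>n\<in>?A. r n ^ l n) * B" by simp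
  next
    fix u :: real assume u: "u \<in> {-1..1}"
    have "(\<lambda>M. \<phi> M * (\<Sum>n\<in>?A. x u n) ^ M) sums csqrt (1 - (\<Sum>n\<in>?A. x u n))"
      unfolding \<phi>_def using csqrt_binomial_series[OF x_sum'[OF u]] .
    from has_sum_multinom[OF _ x_sum[OF u] \<phi> this]
    have "((\<lambda>l. f l u) has_sum (csqrt (1 - (\<Sum>n\<in>?A. x u n)) * (ly u * ls' u))) (?A \<rightarrow>\<^sub>E UNIV)"
      unfolding f_def by (intro has_sum_cmult_left) simp
    then show "((\<lambda>l. f l u) has_sum lyb b u * ls' u) (?A \<rightarrow>\<^sub>E UNIV)" by (simp add: lyb_eq mult_ac)
  next
    show "(\<lambda>l. multinom ?A l * (\<Prod>n\<in>?A. r n ^ l n) * B) summable_on (?A \<rightarrow>\<^sub>E UNIV)"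
      by (intro summable_on_cmult_left summable_multinom r) (use m in \<open>auto simp: r_def\<close>)
  qed
  have "continuous_on {-1..1} (\<lambda>u. \<Sum>l\<in>X. f l u)" for X
    unfolding f_eq by (intro continuous_intros continuous_on_lint)
  from uniform_limit_integral[OF lim this] obtain I J where
    I: "\<And>X. ((\<lambda>u. \<Sum>l\<in>X. f l u) has_integral I X) {-1..1}"
    and J: "((\<lambda>u. lyb b u * ls' u) has_integral J) {-1..1}"
    and IJ: "(I \<longlongrightarrow> J) (finite_subsets_at_top (?A \<rightarrow>\<^sub>E UNIV))" by auto
  define k where "k = - (complex_of_real (sqrt pi) / of_nat N)"
  have k: "k \<noteq> 0" using N_pos by (simp add: k_def)
  have f_int: "(f l has_integral k * R_term N 1 b l) {-1..1}" for l
  proof -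
    have "1 \<le> Lsum N l" by (simp add: Lsum_def)
    from has_integral_mult_right[OF has_integral_lint[OF this], of "coef l" "Msum N l"]
    show ?thesis
      unfolding f_eq[abs_def] k_def multinom_lint_coefficient[OF N_pos, symmetric]
      by (simp only: coef_def \<phi>_def Msum_def)
  qed
  have "I X = (\<Sum>l\<in>X. k * R_term N 1 b l)" if "finite X" for X
    using I has_integral_sum[OF that f_int] by (rule has_integral_unique)
  then have "eventually (\<lambda>X. I X = (\<Sum>l\<in>X. k * R_term N 1 b l)) (finite_subsets_at_top (?A \<rightarrow>\<^sub>E UNIV))"
    by (auto intro: eventually_finite_subsets_at_top_weakI)
  with IJ have "((\<lambda>l. k * R_term N 1 b l) has_sum J) (?A \<rightarrow>\<^sub>E UNIV)"
    unfolding has_sum_def by (rule Lim_transform_eventually)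
  then have "((\<lambda>l. 1 / k * (k * R_term N 1 b l)) has_sum (1 / k * J)) (?A \<rightarrow>\<^sub>E UNIV)"
    by (rule has_sum_cmult_right)
  then have S: "(R_term N 1 b has_sum (1 / k * J)) (?A \<rightarrow>\<^sub>E UNIV)" using k by simp
  show ?thesis
  proof (rule that[OF S _ sq cont nz])
    have eq: "- (of_real (sqrt pi) / of_nat N) * (1 / k * J) = J" using k unfolding k_def [symmetric] by simp
    show "((\<lambda>u. lyb b u * ls' u) has_integral - (of_real (sqrt pi) / of_nat N) * (1 / k * J)) {-1..1}"
      unfolding eq by (rule J)
  qed
qed

section \<open>The Seiberg-Witten integral\<close>

text \<open>Path and loop share the odd primitive \<open>A\<close> attached to the root
  \<open>a\<close>. The loop runs from - 1/q(0) to 1/q(0) and gives 2 A(1/q(0)); a path from 0 to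
  \<open>a\<close> runs from 1/q(0) to 0 and gives minus half of that.\<close>

lemma path_integral:
  assumes m: "m > 0" "\<And>u. u \<in> {-1..1} \<Longrightarrow> m \<le> norm (1 - ls u ^ N)"
    and b: "(\<Sum>n=1..N-2. norm (b n) * 2 ^ N / m) < 1"
    and a: "a \<in> tube \<rho>" "spoly N b a = 0" and K: "\<And>s. s \<in> tube \<rho> \<Longrightarrow> Re (squot N b a s) > 0"
  obtains S where "(R_term N 1 b has_sum S) ({1..N-2} \<rightarrow>\<^sub>E UNIV)"
    and "\<forall>\<gamma> \<gamma>' y X. finite X \<longrightarrow> continuous_on {0..1} y \<longrightarrow> continuous_on {0..1} \<gamma> \<longrightarrow> (\<forall>t\<in>{0..1}. \<gamma> t \<in> tube \<rho>) \<longrightarrow>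
       \<gamma> 0 = 0 \<longrightarrow> \<gamma> 1 = a \<longrightarrow> y 0 = 1 \<longrightarrow> (\<forall>t\<in>{0..1}. (y t)\<^sup>2 = spoly N b (\<gamma> t)) \<longrightarrow>
       (\<forall>t\<in>{0<..<1} - X. spoly N b (\<gamma> t) \<noteq> 0 \<and> (\<gamma> has_vector_derivative \<gamma>' t) (at t)) \<longrightarrow>
       ((\<lambda>t. y t * \<gamma>' t) has_integral (of_real (sqrt pi) / (2 * of_nat N) * S)) {0..1}"
proof -
  define q where "q = (\<lambda>s. csqrt (squot N b a s))"
  have spoly_eq: "spoly N b s = (a - s) * squot N b a s" for s
    using spoly_diff[of N b s a] a by simp
  have q_sq: "(q s)\<^sup>2 = squot N b a s" for s by (simp add: q_def)
  have q_nz: "q s \<noteq> 0" if "s \<in> tube \<rho>" for s using K[OF that] by (auto simp: q_def)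
  have q_hol: "q holomorphic_on tube \<rho>"
    unfolding q_def
  proof (rule holomorphic_on_csqrt')
    show "squot N b a holomorphic_on tube \<rho>"
      unfolding squot_def by (intro holomorphic_intros)
    show "squot N b a s \<notin> \<real>\<^sub>\<le>\<^sub>0" if "s \<in> tube \<rho>" for s
      using K[OF that] unfolding complex_nonpos_Reals_iff by linarith
  qed
  obtain A where odd: "\<forall>w. A (- w) = - A w"
    and A: "\<forall>\<alpha> \<beta> \<gamma> \<gamma>' \<eta> X. \<alpha> \<le> \<beta> \<longrightarrow> finite X \<longrightarrow> continuous_on {\<alpha>..\<beta>} \<eta> \<longrightarrow>
       (\<forall>t\<in>{\<alpha>..\<beta>}. \<gamma> t \<in> tube \<rho>) \<longrightarrow> (\<forall>t\<in>{\<alpha>..\<beta>}. (\<eta> t)\<^sup>2 = a - \<gamma> t) \<longrightarrow>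
       (\<forall>t\<in>{\<alpha><..<\<beta>} - X. \<eta> t \<noteq> 0 \<and> (\<gamma> has_vector_derivative \<gamma>' t) (at t)) \<longrightarrow>
       ((\<lambda>t. \<eta> t * q (\<gamma> t) * \<gamma>' t) has_integral (A (\<eta> \<beta>) - A (\<eta> \<alpha>))) {\<alpha>..\<beta>}"
    by (rule sqrt_path_primitive[OF open_tube convex_tube a(1) q_hol])
  have A0: "A 0 = 0" using odd[rule_format, of 0] by simp
  \<comment> \<open>Dividing \<open>y\<close> by \<open>q\<close> along the path yields a lift to
    the coordinate \<open>w\<close>, a continuous square root of
    \<open>a - \<gamma> t\<close>.\<close>
  have A': "((\<lambda>t. y t * \<gamma>' t) has_integral (A (y \<beta> / q (\<gamma> \<beta>)) - A (y \<alpha> / q (\<gamma> \<alpha>)))) {\<alpha>..\<beta>}"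
    if "\<alpha> \<le> \<beta>" "finite X" "continuous_on {\<alpha>..\<beta>} y" "continuous_on {\<alpha>..\<beta>} \<gamma>"
      and \<gamma>: "\<And>t. t \<in> {\<alpha>..\<beta>} \<Longrightarrow> \<gamma> t \<in> tube \<rho>"
      and y: "\<And>t. t \<in> {\<alpha>..\<beta>} \<Longrightarrow> (y t)\<^sup>2 = spoly N b (\<gamma> t)"
      and nz: "\<And>t. t \<in> {\<alpha><..<\<beta>} - X \<Longrightarrow> y t \<noteq> 0"
      and d: "\<And>t. t \<in> {\<alpha><..<\<beta>} - X \<Longrightarrow> (\<gamma> has_vector_derivative \<gamma>' t) (at t)"
    for \<alpha> \<beta> X y \<gamma> \<gamma>'
  proof -
    have "((\<lambda>t. y t / q (\<gamma> t) * q (\<gamma> t) * \<gamma>' t) has_integral (A (y \<beta> / q (\<gamma> \<beta>)) - A (y \<alpha> / q (\<gamma> \<alpha>)))) {\<alpha>..\<beta>}"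
    proof (rule A[rule_format, where X = X and \<eta> = "\<lambda>t. y t / q (\<gamma> t)" and \<gamma> = \<gamma> and \<gamma>' = \<gamma>' and \<alpha> = \<alpha> and \<beta> = \<beta>])
      have "continuous_on {\<alpha>..\<beta>} (\<lambda>t. q (\<gamma> t))"
        using continuous_on_compose2[OF holomorphic_on_imp_continuous_on[OF q_hol] that(4)] \<gamma> by blast
      then show "continuous_on {\<alpha>..\<beta>} (\<lambda>t. y t / q (\<gamma> t))"
        using that(3) q_nz \<gamma> by (intro continuous_on_divide) auto
      show "(y t / q (\<gamma> t))\<^sup>2 = a - \<gamma> t" if "t \<in> {\<alpha>..\<beta>}" for t
      proof -
        have "squot N b a (\<gamma> t) \<noteq> 0" using K[OF \<gamma>[OF that]] by auto
        then show ?thesis by (simp add: power_divide y[OF that] spoly_eq q_sq)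
      qed
      show "y t / q (\<gamma> t) \<noteq> 0 \<and> (\<gamma> has_vector_derivative \<gamma>' t) (at t)" if t: "t \<in> {\<alpha><..<\<beta>} - X" for t
        using nz[OF t] d[OF t] q_nz[OF \<gamma>, of t] t by auto
    qed (use that \<gamma> in auto)
    then show ?thesis
      by (rule has_integral_eq[rotated]) (use q_nz \<gamma> in auto)
  qed
  obtain S where S: "(R_term N 1 b has_sum S) ({1..N-2} \<rightarrow>\<^sub>E UNIV)"
    and loop: "((\<lambda>u. lyb b u * ls' u) has_integral (- (of_real (sqrt pi) / of_nat N) * S)) {-1..1}"
    and lyb: "\<And>u. u \<in> {-1..1} \<Longrightarrow> (lyb b u)\<^sup>2 = spoly N b (ls u)" "continuous_on {-1..1} (lyb b)"
      "\<And>u. u \<in> {-1..1} \<Longrightarrow> lyb b u \<noteq> 0"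
    using loop_integral[OF m b] by blast
  \<comment> \<open>At \<open>s = 0\<close> the perturbation vanishes, since its terms have positive
    degree, so the end values of \<open>ly\<close> are kept.\<close>
  have lyb_ends: "lyb b 1 = 1" "lyb b (-1) = -1"
    using N_pos by (simp_all add: lyb_def power_0_left)
  have "((\<lambda>u. lyb b u * ls' u) has_integral (A (lyb b 1 / q (ls 1)) - A (lyb b (-1) / q (ls (-1))))) {-1..1}"
    using lyb ls_tube by (intro A'[where X = "{}" and y = "lyb b" and \<gamma> = ls and \<beta> = 1 and \<alpha> = "-1" and \<gamma>' = ls'])
      (auto intro: continuous_on_ls has_vector_derivative_ls)
  from has_integral_unique[OF this loop]
  have A1: "2 * A (1 / q 0) = - (of_real (sqrt pi) / of_nat N) * S"
    using odd[rule_format, of "1 / q 0"] by (simp add: lyb_ends)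
  have "A (1 / q 0) = (2 * A (1 / q 0)) / 2" by simp
  also have "\<dots> = - (of_real (sqrt pi) / (2 * of_nat N) * S)" unfolding A1 by simp
  finally have A1: "A (1 / q 0) = - (of_real (sqrt pi) / (2 * of_nat N) * S)" .
  show ?thesis
  proof (rule that[OF S], intro allI impI)
    fix \<gamma> \<gamma>' y :: "real \<Rightarrow> complex" and X :: "real set"
    assume *: "finite X" "continuous_on {0..1} y" "continuous_on {0..1} \<gamma>" "\<forall>t\<in>{0..1}. \<gamma> t \<in> tube \<rho>" "\<gamma> 0 = 0" "\<gamma> 1 = a" "y 0 = 1"
      "\<forall>t\<in>{0..1}. (y t)\<^sup>2 = spoly N b (\<gamma> t)"
      "\<forall>t\<in>{0<..<1} - X. spoly N b (\<gamma> t) \<noteq> 0 \<and> (\<gamma> has_vector_derivative \<gamma>' t) (at t)"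
    have "(y 1)\<^sup>2 = 0" using * a by simp
    then have y1: "y 1 = 0" by simp
    have "((\<lambda>t. y t * \<gamma>' t) has_integral (A (y 1 / q (\<gamma> 1)) - A (y 0 / q (\<gamma> 0)))) {0..1}"
    proof (rule A'[where X = X and y = y and \<gamma> = \<gamma> and \<beta> = 1 and \<alpha> = 0 and \<gamma>' = \<gamma>'])
      show "y t \<noteq> 0" if t: "t \<in> {0<..<1} - X" for t
      proof -
        have "(y t)\<^sup>2 = spoly N b (\<gamma> t)" "spoly N b (\<gamma> t) \<noteq> 0" using *(8,9) t by auto
        then show ?thesis by auto
      qed
    qed (use * in auto)
    then show "((\<lambda>t. y t * \<gamma>' t) has_integral (of_real (sqrt pi) / (2 * of_nat N) * S)) {0..1}"
      by (simp add: y1 *(5,7) A0 A1)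
  qed
qed

end

section \<open>Passage from the curve to the rescaled polynomial\<close>

lemma norm_root_eq_1:
  assumes \<zeta>: "\<zeta> ^ N = (-1 :: complex)" and "N \<ge> 1"
  shows "norm \<zeta> = 1"
proof (rule power_eq_imp_eq_base)
  show "norm \<zeta> ^ N = 1 ^ N" by (metis \<zeta> norm_power norm_minus_cancel norm_one power_one)
qed (use assms in auto)

lemma zpoly_scale:
  assumes "\<zeta> ^ N = -1"
  shows "zpoly N c (\<zeta> * s) = spoly N (\<lambda>n. c n * \<zeta> ^ n) s"
  using assms by (simp add: zpoly_def spoly_def power_mult_distrib mult_ac)

text \<open>With the logarithm fixed, \<open>vpow lv\<close> turns sums of exponents into products,
  so the powers of \<open>v\<close> in the rescaled moduli and in \<open>x\<close> combine to a
  single factor \<open>v\<close>.\<close>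

lemma SW_curve_scale:
  assumes N: "N \<ge> 1" and v: "exp lv = v"
  shows "SW_curve N u v (vpow lv (1 / real N) * z) = v * zpoly N (vmod N lv u) z"
proof -
  have pow: "vpow lv (1 / real N) ^ n = vpow lv (real n / real N)" for n
    by (simp add: vpow_def exp_of_nat_mult [symmetric])
  have "vpow lv (1 / real N) ^ N = v"
    unfolding pow using N v by (simp add: vpow_def)
  then have xN: "(vpow lv (1 / real N) * z) ^ N = v * z ^ N" by (simp add: power_mult_distrib)
  have "u n * vpow lv (1 / real N) ^ n = v * vmod N lv u n" for n
    unfolding pow unfolding vmod_def v [symmetric] vpow_def by (simp add: exp_add [symmetric] algebra_simps)
  then have un: "u n * (vpow lv (1 / real N) * z) ^ n = v * (vmod N lv u n * z ^ n)" for n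
    unfolding power_mult_distrib mult.assoc [symmetric] by simp
  show ?thesis
    unfolding SW_curve_def zpoly_def un xN by (simp add: sum_distrib_left algebra_simps)
qed

text \<open>The summand 1 in \<open>Lsum\<close> gives the factor \<open>\<zeta>\<close> in front;
  the remaining powers of \<open>\<zeta>\<close> are absorbed into the coefficients.\<close>

lemma R_term_scale: "R_term N \<zeta> c l = \<zeta> * R_term N 1 (\<lambda>n. c n * \<zeta> ^ n) l"
proof -
  have "\<zeta> ^ Lsum N l = \<zeta> * (\<Prod>n=1..N-2. (\<zeta> ^ n) ^ l n)"
    by (simp add: Lsum_def power_sum flip: power_mult)
  moreover have "(\<Prod>n=1..N-2. (c n * \<zeta> ^ n) ^ l n) = (\<Prod>n=1..N-2. c n ^ l n) * (\<Prod>n=1..N-2. (\<zeta> ^ n) ^ l n)"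
    by (simp only: power_mult_distrib prod.distrib)
  ultimately show ?thesis unfolding R_term_def by (simp only: power_one) (simp only: mult_ac times_divide_eq_left times_divide_eq_right mult_1)
qed

text \<open>Links the derivative within the interval, used in \<open>has_SW_integral\<close>, to the
  two-sided one used for the primitive.\<close>

lemma vector_derivative_cmult_within_Icc:
  fixes \<gamma> :: "real \<Rightarrow> complex"
  assumes "\<gamma> differentiable at t" "t \<in> {0<..<1}"
  shows "vector_derivative (\<lambda>s. c * \<gamma> s) (at t within {0..1}) = c * vector_derivative \<gamma> (at t)"
proof (rule vector_derivative_within_closed_interval)
  have "(\<gamma> has_vector_derivative vector_derivative \<gamma> (at t)) (at t)"
    using assms by (simp add: vector_derivative_works)
  then show "((\<lambda>s. c * \<gamma> s) has_vector_derivative c * vector_derivative \<gamma> (at t)) (at t within {0..1})"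
    by (rule has_vector_derivative_mult_right[OF has_vector_derivative_at_within])
qed (use assms in auto)

context hsum_tube
begin

text \<open>The radius \<open>r\<close> confines the branch point and the admissible paths, while
  the loop depends only on \<open>\<rho>\<close>. Hence one bound \<open>m\<close> serves every
  \<open>r\<close> up to \<open>\<rho>\<close>.\<close>

lemma SW_R_expansion:
  fixes lv v :: complex and u :: "nat \<Rightarrow> complex" and r :: real
  defines "c \<equiv> vmod N lv u"
  assumes v: "exp lv = v" and \<zeta>: "\<zeta> ^ N = -1" and r: "r \<le> \<rho>"
  defines "b \<equiv> \<lambda>n. c n * \<zeta> ^ n"
  assumes m: "m > 0" "\<And>u. u \<in> {-1..1} \<Longrightarrow> m \<le> norm (1 - ls u ^ N)"
    and b: "(\<Sum>n=1..N-2. norm (b n) * 2 ^ N / m) < 1"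
    and a: "a \<in> ball 1 r" "spoly N b a = 0" and K: "\<And>s. s \<in> tube \<rho> \<Longrightarrow> Re (squot N b a s) > 0"
  shows "(\<exists>!z. z \<in> ball \<zeta> r \<and> zpoly N c z = 0) \<and>
    (\<exists>!R. has_SW_integral r N u v lv \<zeta> (\<i> * of_real pi * R)) \<and>
    (\<exists>S. (R_term N \<zeta> c has_sum S) ({1..N-2} \<rightarrow>\<^sub>E UNIV) \<and>
      SW_R r N u v lv \<zeta> = - (vpow lv (1/2 + 1 / real N) / (of_real (sqrt (2 * pi)) * of_nat N)) * S)"
proof -
  have n\<zeta>: "norm \<zeta> = 1" by (rule norm_root_eq_1[OF \<zeta> N_pos])
  then have \<zeta>0: "\<zeta> \<noteq> 0" by auto
  have dist_scale: "dist (\<zeta> * x) (\<zeta> * y) = dist x y" for x y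
    by (simp add: dist_norm norm_mult n\<zeta> flip: right_diff_distrib)
  have zs: "zpoly N c (\<zeta> * s) = spoly N b s" for s unfolding b_def by (rule zpoly_scale[OF \<zeta>])
  have spoly_eq: "spoly N b s = (a - s) * squot N b a s" for s
    using spoly_diff[of N b s a] a by simp
  have aT: "a \<in> tube \<rho>" using a r ball_subset_tube[of \<rho>] by auto
  have root_iff: "spoly N b s = 0 \<longleftrightarrow> s = a" if "s \<in> tube \<rho>" for s
    using K[OF that] by (auto simp: spoly_eq)
  have root: "z \<in> ball \<zeta> r \<and> zpoly N c z = 0 \<longleftrightarrow> z = \<zeta> * a" for z
  proof -
    define s where "s = z / \<zeta>"
    have z: "z = \<zeta> * s" using \<zeta>0 by (simp add: s_def)
    have "z \<in> ball \<zeta> r \<longleftrightarrow> s \<in> ball 1 r" using dist_scale[of 1 s] by (simp add: z)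
    moreover have "s \<in> tube \<rho>" if "s \<in> ball 1 r"
      using that r ball_subset_tube[of \<rho>] by auto
    ultimately show ?thesis
      using root_iff[of s] a \<zeta>0 by (auto simp: z zs)
  qed
  then have bp: "branch_point r N c \<zeta> = \<zeta> * a" unfolding branch_point_def by simp
  define w where "w = vpow lv (1/2)"
  define x where "x = vpow lv (1 / real N)"
  have w: "w\<^sup>2 = v" "w \<noteq> 0" using v by (simp_all add: w_def vpow_def flip: exp_of_nat_mult)
  have v0: "v \<noteq> 0" using v by auto
  have curve: "SW_curve N u v (x * (\<zeta> * s)) = v * spoly N b s" for s
    unfolding x_def SW_curve_scale[OF N_pos v] c_def [symmetric] zs ..
  obtain S where S: "(R_term N 1 b has_sum S) ({1..N-2} \<rightarrow>\<^sub>E UNIV)"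
    and int: "\<forall>\<gamma> \<gamma>' y X. finite X \<longrightarrow> continuous_on {0..1} y \<longrightarrow> continuous_on {0..1} \<gamma> \<longrightarrow> (\<forall>t\<in>{0..1}. \<gamma> t \<in> tube \<rho>) \<longrightarrow>
       \<gamma> 0 = 0 \<longrightarrow> \<gamma> 1 = a \<longrightarrow> y 0 = 1 \<longrightarrow> (\<forall>t\<in>{0..1}. (y t)\<^sup>2 = spoly N b (\<gamma> t)) \<longrightarrow>
       (\<forall>t\<in>{0<..<1} - X. spoly N b (\<gamma> t) \<noteq> 0 \<and> (\<gamma> has_vector_derivative \<gamma>' t) (at t)) \<longrightarrow>
       ((\<lambda>t. y t * \<gamma>' t) has_integral (of_real (sqrt pi) / (2 * of_nat N) * S)) {0..1}"
    by (rule path_integral[OF m b aT a(2) K])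
  define J where "J = (- \<i> * of_real (sqrt 2)) * w * x * \<zeta> * (of_real (sqrt pi) / (2 * of_nat N) * S)"
  have lifted_int: "((\<lambda>t. (- \<i> * of_real (sqrt 2)) * y t *
      vector_derivative (\<lambda>s. x * \<gamma> s) (at t within {0..1})) has_integral J) {0..1}"
    if lift: "lifted_segment r N u v lv \<zeta> \<gamma> y" for \<gamma> y
  proof -
    note L = lift[unfolded lifted_segment_def, folded c_def w_def x_def, unfolded bp]
    have "\<gamma> piecewise_C1_differentiable_on {0..1}" using L by (simp add: valid_path_def)
    then obtain X where X: "finite X" "\<gamma> C1_differentiable_on ({0..1} - X)" and cont: "continuous_on {0..1} \<gamma>"
      by (auto simp: piecewise_C1_differentiable_on_def)
    have diff: "\<gamma> differentiable at t" if "t \<in> {0<..<1} - X" for t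
      using X(2) that by (auto simp: C1_differentiable_on_eq)
    \<comment> \<open>Dividing the path by \<open>\<zeta>\<close> and the lift by \<open>w\<close>
      brings an arbitrary admissible path into the normalised situation with root
      \<open>a\<close>.\<close>
    define \<sigma> where "\<sigma> = (\<lambda>t. \<gamma> t / \<zeta>)"
    have \<gamma>: "\<gamma> t = \<zeta> * \<sigma> t" for t using \<zeta>0 by (simp add: \<sigma>_def)
    have "((\<lambda>t. y t / w * (vector_derivative \<gamma> (at t) / \<zeta>)) has_integral (of_real (sqrt pi) / (2 * of_nat N) * S)) {0..1}"
    proof (rule int[rule_format, where X = X and \<gamma> = \<sigma>])
      show "continuous_on {0..1} (\<lambda>t. y t / w)" "continuous_on {0..1} \<sigma>"
        unfolding \<sigma>_def using L cont w \<zeta>0 by (auto intro!: continuous_intros)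
      show "\<sigma> t \<in> tube \<rho>" if t: "t \<in> {0..1}" for t
      proof -
        have "dist (\<gamma> t) (\<zeta> * of_real t) < r" using L t by (auto simp: linepath_def scaleR_conv_of_real mult.commute)
        then show ?thesis using t r unfolding \<gamma> dist_scale tube_iff by force
      qed
      show "\<sigma> 0 = 0" "\<sigma> 1 = a" "y 0 / w = 1"
        using L w \<zeta>0 by (auto simp: \<sigma>_def pathstart_def pathfinish_def)
      show "(y t / w)\<^sup>2 = spoly N b (\<sigma> t)" if t: "t \<in> {0..1}" for t
        using L t w v0 by (auto simp: power_divide \<gamma> curve)
      show "spoly N b (\<sigma> t) \<noteq> 0 \<and> (\<sigma> has_vector_derivative vector_derivative \<gamma> (at t) / \<zeta>) (at t)"
        if t: "t \<in> {0<..<1} - X" for t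
      proof
        have "zpoly N c (\<gamma> t) \<noteq> 0" using L t by auto
        then show "spoly N b (\<sigma> t) \<noteq> 0" by (simp add: \<gamma> zs)
        show "(\<sigma> has_vector_derivative vector_derivative \<gamma> (at t) / \<zeta>) (at t)"
          unfolding \<sigma>_def using diff[OF t] by (rule has_vector_derivative_divide[OF iffD1[OF vector_derivative_works]])
      qed
    qed (use X in auto)
    from has_integral_mult_right[OF this, of "(- \<i> * of_real (sqrt 2)) * w * x * \<zeta>"]
    have "((\<lambda>t. (- \<i> * of_real (sqrt 2)) * w * x * \<zeta> * (y t / w * (vector_derivative \<gamma> (at t) / \<zeta>))) has_integral J) {0..1}"
      unfolding J_def .
    then show ?thesis
    proof (rule has_integral_spike_finite[rotated 2])
      show "finite (X \<union> {0, 1})" using X by simp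
      fix t assume "t \<in> {0..1} - (X \<union> {0, 1})"
      then have t: "t \<in> {0<..<1} - X" by auto
      show "(- \<i> * of_real (sqrt 2)) * y t * vector_derivative (\<lambda>s. x * \<gamma> s) (at t within {0..1})
          = (- \<i> * of_real (sqrt 2)) * w * x * \<zeta> * (y t / w * (vector_derivative \<gamma> (at t) / \<zeta>))"
        using vector_derivative_cmult_within_Icc[OF diff[OF t], of x] t w \<zeta>0 by simp
    qed
  qed
  \<comment> \<open>Existence is witnessed by the straight segment to the branch point.\<close>
  have "\<exists>\<gamma> y. lifted_segment r N u v lv \<zeta> \<gamma> y"
  proof (intro exI)
    define K0 where "K0 = squot N b a 0"
    have aK0: "a * K0 = 1"
      using spoly_eq[of 0] N_pos by (simp add: spoly_def K0_def power_0_left)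
    have "0 \<in> tube \<rho>" using segment_tube[OF \<rho>_pos, of 0] by simp
    then have K0: "K0 \<noteq> 0" using K[of 0] by (auto simp: K0_def)
    have seg: "of_real t * a \<in> tube \<rho>" if "t \<in> {0..1}" for t
      using convexD_alt[OF convex_tube \<open>0 \<in> tube \<rho>\<close> aT, of t] that by (simp add: scaleR_conv_of_real)
    \<comment> \<open>On this segment \<open>spoly\<close> is \<open>a * (1 - t)\<close> times the
      cofactor, and \<open>a\<close> is the inverse of \<open>K0\<close>. Dividing by the root of
      \<open>K0\<close> therefore gives the right square and the initial value
      \<open>w\<close>.\<close>
    define y where "y = (\<lambda>t. w * (csqrt (squot N b a (of_real t * a)) / csqrt K0 * of_real (sqrt (1 - t))))"
    have lp: "linepath 0 (\<zeta> * a) t = \<zeta> * (of_real t * a)" for t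
      by (simp add: linepath_def scaleR_conv_of_real)
    have r0: "r > 0" using a(1) by (metis ball_eq_empty empty_iff not_less)
    have "dist (linepath 0 (\<zeta> * a) t) (linepath 0 \<zeta> t) < r" if t: "t \<in> {0..1}" for t
    proof -
      have "linepath 0 (\<zeta> * a) t - linepath 0 \<zeta> t = \<zeta> * (of_real t * (a - 1))"
        by (simp add: linepath_def scaleR_conv_of_real algebra_simps)
      then have "dist (linepath 0 (\<zeta> * a) t) (linepath 0 \<zeta> t) = t * dist 1 a"
        using t by (simp add: dist_norm norm_mult n\<zeta> norm_minus_commute)
      also have "\<dots> \<le> 1 * dist 1 a" using t by (intro mult_right_mono) auto
      also have "\<dots> < r" using a by simp
      finally show ?thesis .
    qed
    moreover have "zpoly N c (linepath 0 (\<zeta> * a) t) \<noteq> 0" if t: "t \<in> {0..<1}" for t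
    proof -
      have "of_real t * a \<noteq> a" using t aK0 by auto
      then show ?thesis unfolding lp zs using root_iff[OF seg[of t]] t by auto
    qed
    moreover have "continuous_on {0..1} y"
    proof -
      have "continuous_on {0..1} (\<lambda>t. csqrt (squot N b a (of_real t * a)))"
      proof (rule continuous_on_compose2[OF continuous_on_csqrt])
        show "continuous_on {0..1} (\<lambda>t. squot N b a (complex_of_real t * a))"
          unfolding squot_def hsum_def by (intro continuous_intros)
        show "(\<lambda>t. squot N b a (complex_of_real t * a)) ` {0..1} \<subseteq> - \<real>\<^sub>\<le>\<^sub>0"
        proof (intro image_subsetI ComplI)
          fix t :: real assume "t \<in> {0..1}" "squot N b a (of_real t * a) \<in> \<real>\<^sub>\<le>\<^sub>0"
          then show False using K[OF seg[of t]] unfolding complex_nonpos_Reals_iff by linarith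
        qed
      qed
      then show ?thesis unfolding y_def using K0 by (intro continuous_intros) auto
    qed
    moreover have "y 0 = w" using K0 by (simp add: y_def flip: K0_def)
    moreover have "(y t)\<^sup>2 = SW_curve N u v (x * linepath 0 (\<zeta> * a) t)" if t: "t \<in> {0..1}" for t
    proof -
      have "(y t)\<^sup>2 = v * (squot N b a (of_real t * a) / K0 * of_real (1 - t))"
        using t by (simp add: y_def power_mult_distrib power_divide w flip: of_real_power)
      also have "squot N b a (of_real t * a) / K0 = a * squot N b a (of_real t * a)"
        using aK0 K0 by (simp add: field_simps)
      also have "a * squot N b a (of_real t * a) * of_real (1 - t) = spoly N b (of_real t * a)"
        by (simp add: spoly_eq algebra_simps)
      finally show ?thesis unfolding lp curve .
    qed
    ultimately show "lifted_segment r N u v lv \<zeta> (linepath 0 (\<zeta> * a)) y"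
      unfolding lifted_segment_def c_def [symmetric] w_def [symmetric] x_def [symmetric] bp by auto
  qed
  \<comment> \<open>An admissible lift exists and all of them integrate to \<open>J\<close>, so the
    definite description in \<open>SW_R\<close> has a unique solution.\<close>
  then have SW_iff: "has_SW_integral r N u v lv \<zeta> I \<longleftrightarrow> I = J" for I
    unfolding has_SW_integral_def x_def [symmetric] using lifted_int has_integral_unique by blast
  define R where "R = - (vpow lv (1/2 + 1 / real N) / (of_real (sqrt (2 * pi)) * of_nat N)) * (\<zeta> * S)"
  have "J = \<i> * of_real pi * R"
  proof -
    have V: "w * x = vpow lv (1/2 + 1 / real N)"
      by (simp add: w_def x_def vpow_def exp_add [symmetric] algebra_simps)
    have "sqrt 2 * sqrt pi / 2 = pi / sqrt (2 * pi)"
      by (simp add: real_sqrt_mult field_simps)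
    then have pi: "complex_of_real (sqrt 2) * of_real (sqrt pi) / 2 = of_real pi / of_real (sqrt (2 * pi))"
      by (metis of_real_divide of_real_mult of_real_numeral)
    have "J = - \<i> * (complex_of_real (sqrt 2) * of_real (sqrt pi) / 2) * (w * x) / of_nat N * (\<zeta> * S)"
      by (simp add: J_def)
    also have "\<dots> = \<i> * of_real pi * R"
      unfolding V pi by (simp add: R_def)
    finally show ?thesis .
  qed
  then have R_iff: "has_SW_integral r N u v lv \<zeta> (\<i> * of_real pi * R') \<longleftrightarrow> R' = R" for R'
    by (simp add: SW_iff)
  have "((\<lambda>l. \<zeta> * R_term N 1 b l) has_sum (\<zeta> * S)) ({1..N-2} \<rightarrow>\<^sub>E UNIV)"
    by (rule has_sum_cmult_right[OF S])
  then have "(R_term N \<zeta> c has_sum (\<zeta> * S)) ({1..N-2} \<rightarrow>\<^sub>E UNIV)"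
    by (simp add: b_def flip: R_term_scale)
  moreover have "SW_R r N u v lv \<zeta> = R" unfolding SW_R_def R_iff by simp
  ultimately show ?thesis unfolding root R_iff R_def by blast
qed

end

section \<open>Choice of the radii, uniform in the moduli\<close>

theorem corollary4p1:
  fixes N :: nat
  assumes "N \<ge> 3"
  shows "\<exists>\<rho>\<^sub>0>0. \<forall>\<rho>. 0 < \<rho> \<and> \<rho> \<le> \<rho>\<^sub>0 \<longrightarrow>
    (\<exists>\<delta>>0. \<forall>(v::complex) lv (u :: nat \<Rightarrow> complex).
       v \<noteq> 0 \<and> exp lv = v \<and> (\<forall>n\<in>{1..N-2}. norm (vmod N lv u n) < \<delta>) \<longrightarrow>
       (\<forall>\<zeta>. \<zeta> ^ N = -1 \<longrightarrow>
          (\<exists>!z. z \<in> ball \<zeta> \<rho> \<and> zpoly N (vmod N lv u) z = 0) \<and>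
          (\<exists>!r. has_SW_integral \<rho> N u v lv \<zeta> (\<i> * of_real pi * r)) \<and>
          (\<exists>S. (R_term N \<zeta> (vmod N lv u) has_sum S) ({1..N-2} \<rightarrow>\<^sub>E UNIV) \<and>
               SW_R \<rho> N u v lv \<zeta>
                 = - (vpow lv (1/2 + 1 / real N) / (of_real (sqrt (2 * pi)) * of_nat N)) * S)) \<and>
       (\<forall>i\<in>{1..(N-1) div 2}.
          short_a \<rho> N u v lv i
            = (\<Sum>j=1..i. SW_R \<rho> N u v lv (eps N ^ (4*j - 1)) - SW_R \<rho> N u v lv (eps N ^ (4*j - 3))) \<and>
          short_aD \<rho> N u v lv i
            = SW_R \<rho> N u v lv (eps N ^ (4*i + 1)) - SW_R \<rho> N u v lv (eps N ^ (4*i - 1))))"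
proof -
  obtain \<rho>\<^sub>0 where tube: "hsum_tube N \<rho>\<^sub>0" using ex_hsum_tube[of N] assms by auto
  interpret hsum_tube N \<rho>\<^sub>0 by (rule tube)
  obtain m where m: "m > 0" "\<And>u. u \<in> {-1..1} \<Longrightarrow> m \<le> norm (1 - ls u ^ N)"
    using ex_lower_bound by blast
  show ?thesis
  proof (rule exI[of _ \<rho>\<^sub>0], intro conjI \<rho>_pos allI impI, elim conjE, goal_cases)
    case (1 \<rho>)
    note \<rho> = this
    define C where "C = real N * (real N * 2 ^ N)"
    \<comment> \<open>The bound 1/4 keeps the cofactor in the right half-plane,
      \<open>\<rho> / 16\<close> provides the root, and \<open>m / 2\<close> makes the series
      converge; \<open>C\<close> absorbs the constants depending on \<open>N\<close>.\<close>
    define \<delta> where "\<delta> = min (1/4) (min (\<rho> / 16) (m / 2)) / C"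
    have C: "C > 0" using assms by (simp add: C_def)
    have \<delta>: "\<delta> > 0" using C \<rho> m by (simp add: \<delta>_def)
    have \<delta>C: "\<delta> * C = min (1/4) (min (\<rho> / 16) (m / 2))" using C by (simp add: \<delta>_def)
    have "real N * (\<delta> * 2 ^ N) \<le> real N * (real N * (\<delta> * 2 ^ N))"
      using assms \<delta> mult_right_mono[of 1 "real N" "real N * (\<delta> * 2 ^ N)"] by simp
    then have N\<delta>: "real N * (\<delta> * 2 ^ N) \<le> \<delta> * C" by (simp add: C_def mult_ac)
    have "(\<exists>!z. z \<in> ball \<zeta> \<rho> \<and> zpoly N (vmod N lv u) z = 0) \<and>
          (\<exists>!r. has_SW_integral \<rho> N u v lv \<zeta> (\<i> * of_real pi * r)) \<and>
          (\<exists>S. (R_term N \<zeta> (vmod N lv u) has_sum S) ({1..N-2} \<rightarrow>\<^sub>E UNIV) \<and>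
               SW_R \<rho> N u v lv \<zeta>
                 = - (vpow lv (1/2 + 1 / real N) / (of_real (sqrt (2 * pi)) * of_nat N)) * S)"
      if v: "exp lv = v" and small: "\<forall>n\<in>{1..N-2}. norm (vmod N lv u n) < \<delta>" and \<zeta>: "\<zeta> ^ N = -1"
      for v lv \<zeta> :: complex and u :: "nat \<Rightarrow> complex"
    proof -
      define b where "b = (\<lambda>n. vmod N lv u n * \<zeta> ^ n)"
      have "norm \<zeta> = 1" by (rule norm_root_eq_1[OF \<zeta> N_pos])
      then have b: "norm (b n) \<le> \<delta>" if "n \<in> {1..N-2}" for n
        using small that by (simp add: b_def norm_mult norm_power less_imp_le)
      \<comment> \<open>The root is sought within half the radius, because \<open>ex_root\<close>
        needs a radius strictly below \<open>\<rho>\<^sub>0\<close>, and \<open>\<rho>\<close> may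
        equal it.\<close>
      have "real N * (\<delta> * 2 ^ N) \<le> (\<rho> / 2) / 8" using N\<delta> \<delta>C by simp
      then obtain a where a: "a \<in> ball 1 (\<rho> / 2)" "spoly N b a = 0"
        using ex_root[of "\<rho> / 2" b \<delta>] \<rho> b \<delta> by auto
      have a': "a \<in> ball 1 \<rho>" "a \<in> ball 1 \<rho>\<^sub>0" using a(1) \<rho> by auto
      have K: "Re (squot N b a s) > 0" if "s \<in> tube \<rho>\<^sub>0" for s
      proof (rule squot_pos[OF b _ _ that a'(2)])
        show "real N * (\<delta> * (real N * 2 ^ N)) \<le> 1/4" using \<delta>C by (simp add: C_def mult_ac)
      qed (use \<delta> in auto)
      have "(\<Sum>n=1..N-2. norm (b n) * 2 ^ N / m) \<le> (\<Sum>n=1..N-2. \<delta> * 2 ^ N / m)"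
        using b m by (intro sum_mono divide_right_mono mult_right_mono) auto
      also have "\<dots> = real (N - 2) * (\<delta> * 2 ^ N / m)" by simp
      also have "\<dots> \<le> real N * (\<delta> * 2 ^ N / m)" using m \<delta> by (intro mult_right_mono) auto
      also have "\<dots> = real N * (\<delta> * 2 ^ N) / m" by simp
      also have "\<dots> \<le> (m / 2) / m" using N\<delta> \<delta>C m by (intro divide_right_mono) auto
      also have "\<dots> < 1" using m by simp
      finally have sum: "(\<Sum>n=1..N-2. norm (b n) * 2 ^ N / m) < 1" .
      show ?thesis
        using SW_R_expansion[OF v \<zeta> \<rho>(2) m, of u a] sum a' a(2) K unfolding b_def by blast
    qed
    with \<delta> show ?case
      unfolding short_a_def short_aD_def by blast
  qed
qed

end
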